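(* Let $M,N$ be positive integers varying so that $M+N\to\infty$, and assume $\lim_{M+N\to\infty}M/N=\gamma\in(0,\infty)$. Given $q\in[0,1)$, let $u_N=|u_N|e^{i\theta}$ with $\theta\in(-\pi,\pi]$ and $|u_N|^2=1-\frac1N\lfloor qN\rfloor$, and set $$z_j=\big(\sqrt N\,u_N\big)^M\Big(1+\frac{1}{\sqrt{\gamma MN}}\Big(v_j-\frac{\gamma}{4(1-q)}\Big)\Big)^M,\qquad j=1,\ldots,n.$$ Then the $n$-point correlation functions $R^{(n)}_{M,N}$ of the eigenvalues of $\Pi_M=X_M\cdots X_1$ (a product of i.i.d. $N\times N$ complex Ginibre matrices) satisfy $$\lim_{M+N\to\infty}|z_1\cdots z_n|^2R^{(n)}_{M,N}(z_1,\ldots,z_n)=\begin{cases}\det\big[\mathrm K^{(\mathrm{bulk})}_{\mathrm{crit}}\big(\tfrac{\gamma}{1-q};v_i,v_j\big)\big]_{i,j=1}^n,& q\in(0,1),\\[1ex] \det\big[\mathrm K^{(\mathrm{edge})}_{\mathrm{crit}}(\gamma;v_i,v_j)\big]_{i,j=1}^n,& q=0,\end{cases}$$ uniformly for $v_1,\ldots,v_n$ in a compact subset of $\mathbb C$.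
   Context: $\lfloor x\rfloor$ is the largest integer $\le x$; $n\ge1$ is a fixed integer. Model: $X_1,\ldots,X_M$ are i.i.d. complex Ginibre matrices of size $N\times N$, i.e. each has i.i.d. standard complex Gaussian entries, and $\Pi_M=X_M\cdots X_1$. The eigenvalues of $\Pi_M$ form a determinantal point process in $\mathbb C$ (with respect to Lebesgue measure), with correlation functions $$R^{(n)}_{M,N}(z_1,\ldots,z_n)=\det[K_{M,N}(z_i,z_j)]_{i,j=1}^n,\qquad K_{M,N}(z_1,z_2)=\frac1\pi\sqrt{w(z_1)w(z_2)}\sum_{j=0}^{N-1}\frac{(z_1\overline{z}_2)^j}{\Gamma(j+1)^M},$$ where, for some $c>0$, $$w(z)=\int_{-c-i\infty}^{-c+i\infty}\frac{ds}{2\pi i}\,(\Gamma(-s))^M|z|^{2s}.$$ Critical kernels: for $\beta\in(0,\infty)$ and $z_1,z_2\in\mathbb C$, $$\mathrm K^{(\mathrm{bulk})}_{\mathrm{crit}}(\beta;z_1,z_2)=\frac{1}{\sqrt{2\pi^3\beta}}\,e^{-\frac{1}{2\beta}(|z_1|^2+|z_2|^2+z_1^2+\overline z_2^2)}\sum_{j=-\infty}^{\infty}e^{-\frac12\beta j^2-(z_1+\overline z_2)j},$$ $$\mathrm K^{(\mathrm{edge})}_{\mathrm{crit}}(\beta;z_1,z_2)=\frac{1}{\sqrt{2\pi^3\beta}}\,e^{-\frac{1}{2\beta}(|z_1|^2+|z_2|^2+z_1^2+\overline z_2^2)}\sum_{j=0}^{\infty}e^{-\frac12\beta j^2-(z_1+\overline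 z_2)j}.$$ *)

theory Defs
  imports "HOL-Probability.Probability" "Jordan_Normal_Form.Char_Poly"
begin

text \<open>Matrices are those of \<^theory>\<open>Jordan_Normal_Form.Matrix\<close>, with indices starting at 0. The
  factors of the product are numbered from 1. A point \<open>(z_1, \<dots>, z_n)\<close> is a function
  \<open>z :: nat \<Rightarrow> complex\<close> of which only the values at \<open>{..<n}\<close> matter.\<close>

text \<open>A standard complex Gaussian variable has density \<open>exp (- |z|^2) / \<pi>\<close>, so \<open>E |x|^2 = 1\<close>.
  Joint independence of all entries of all factors expresses both that the entries of each factor
  are independent and that the factors are independent.\<close>

definition ginibre_factors ::
    "'w measure \<Rightarrow> nat \<Rightarrow> nat \<Rightarrow> (nat \<Rightarrow> 'w \<Rightarrow> complex mat) \<Rightarrow> bool" where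
  "ginibre_factors P M N X \<longleftrightarrow>
     prob_space P \<and>
     (\<forall>l\<in>{1..M}. \<forall>\<omega>\<in>space P. X l \<omega> \<in> carrier_mat N N) \<and>
     (\<forall>l\<in>{1..M}. \<forall>i<N. \<forall>j<N.
        distributed P lborel (\<lambda>\<omega>. X l \<omega> $$ (i, j)) (\<lambda>z. ennreal (exp (- (cmod z)\<^sup>2) / pi))) \<and>
     prob_space.indep_vars P (\<lambda>_. borel) (\<lambda>(l, i, j) \<omega>. X l \<omega> $$ (i, j))
       ({1..M} \<times> {..<N} \<times> {..<N})"

primrec matrix_product :: "nat \<Rightarrow> (nat \<Rightarrow> complex mat) \<Rightarrow> nat \<Rightarrow> complex mat" where
  "matrix_product N A 0 = 1\<^sub>m N"
| "matrix_product N A (Suc m) = A (Suc m) * matrix_product N A m"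

text \<open>The eigenvalues, listed with algebraic multiplicity in an unspecified order.\<close>

definition eigenvalue_list :: "complex mat \<Rightarrow> complex list" where
  "eigenvalue_list A = (SOME es. char_poly A = (\<Prod>a\<leftarrow>es. [:- a, 1:]))"

text \<open>\<open>\<rho>\<close> is the \<open>n\<close>-point correlation function, with respect to Lebesgue measure, of the point
  process of the eigenvalues of the random \<open>N \<times> N\<close> matrix \<open>A\<close>:
  \<open>E \<Sum> f(x_{i_1}, \<dots>, x_{i_n}) = \<integral> f \<rho>\<close>, the sum being over all pairwise distinct indices. This
  determines \<open>\<rho>\<close> up to a null set. The sum does not depend on the order of the eigenvalues.\<close>

definition is_eigenvalue_correlation ::
    "'w measure \<Rightarrow> nat \<Rightarrow> ('w \<Rightarrow> complex mat) \<Rightarrow> nat \<Rightarrow> ((nat \<Rightarrow> complex) \<Rightarrow> complex) \<Rightarrow> bool" where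
  "is_eigenvalue_correlation P N A n \<rho> \<longleftrightarrow>
     (let Q = (\<Pi>\<^sub>M i\<in>{..<n}. (lborel :: complex measure)) in
      \<forall>f :: (nat \<Rightarrow> complex) \<Rightarrow> complex. f \<in> borel_measurable Q \<and> bounded (f ` space Q) \<longrightarrow>
        (let S = (\<lambda>\<omega>. \<Sum>s\<in>{s \<in> {..<n} \<rightarrow>\<^sub>E {..<N}. inj_on s {..<n}}.
                    f (\<lambda>i\<in>{..<n}. eigenvalue_list (A \<omega>) ! s i))
         in integrable P S \<and> has_bochner_integral Q (\<lambda>z. f z * \<rho> z) (\<integral>\<omega>. S \<omega> \<partial>P)))"

text \<open>The contour is the upward vertical line through \<open>-c\<close>, parametrized by \<open>s = - c + \<i> t\<close>, so
  that \<open>ds = \<i> dt\<close>.\<close>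

definition ginibre_weight :: "real \<Rightarrow> nat \<Rightarrow> complex \<Rightarrow> complex" where
  "ginibre_weight c M z =
     (\<integral>t. (let s = Complex (- c) t in
             Gamma (- s) ^ M * complex_of_real (cmod z) powr (2 * s) / (2 * complex_of_real pi * \<i>) * \<i>)
        \<partial>lborel)"

definition ginibre_kernel :: "real \<Rightarrow> nat \<Rightarrow> nat \<Rightarrow> complex \<Rightarrow> complex \<Rightarrow> complex" where
  "ginibre_kernel c M N z1 z2 =
     1 / complex_of_real pi * csqrt (ginibre_weight c M z1 * ginibre_weight c M z2) *
     (\<Sum>j<N. (z1 * cnj z2) ^ j / Gamma (of_nat j + 1) ^ M)"

definition kernel_det :: "(complex \<Rightarrow> complex \<Rightarrow> complex) \<Rightarrow> nat \<Rightarrow> (nat \<Rightarrow> complex) \<Rightarrow> complex" where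
  "kernel_det K n z = Determinant.det (mat n n (\<lambda>(i, j). K (z i) (z j)))"

definition crit_prefactor :: "real \<Rightarrow> complex \<Rightarrow> complex \<Rightarrow> complex" where
  "crit_prefactor \<beta> z1 z2 =
     1 / complex_of_real (sqrt (2 * pi ^ 3 * \<beta>)) *
     exp (- (1 / (2 * complex_of_real \<beta>)) *
       (complex_of_real ((cmod z1)\<^sup>2) + complex_of_real ((cmod z2)\<^sup>2) + z1\<^sup>2 + (cnj z2)\<^sup>2))"

definition crit_bulk_kernel :: "real \<Rightarrow> complex \<Rightarrow> complex \<Rightarrow> complex" where
  "crit_bulk_kernel \<beta> z1 z2 = crit_prefactor \<beta> z1 z2 *
     (\<Sum>\<^sub>\<infinity>j\<in>(UNIV :: int set).
        exp (- (1 / 2) * complex_of_real \<beta> * (of_int j)\<^sup>2 - (z1 + cnj z2) * of_int j))"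

definition crit_edge_kernel :: "real \<Rightarrow> complex \<Rightarrow> complex \<Rightarrow> complex" where
  "crit_edge_kernel \<beta> z1 z2 = crit_prefactor \<beta> z1 z2 *
     (\<Sum>j. exp (- (1 / 2) * complex_of_real \<beta> * (of_nat j)\<^sup>2 - (z1 + cnj z2) * of_nat j))"

text \<open>The rescaled point \<open>z_j\<close> as a function of \<open>v_j\<close>.\<close>

definition crit_point ::
    "real \<Rightarrow> real \<Rightarrow> (nat \<Rightarrow> complex) \<Rightarrow> nat \<Rightarrow> nat \<Rightarrow> complex \<Rightarrow> complex" where
  "crit_point \<gamma> q u M N v =
     (complex_of_real (sqrt (real N)) * u N) ^ M *
     (1 + 1 / complex_of_real (sqrt (\<gamma> * real M * real N)) *
        (v - complex_of_real (\<gamma> / (4 * (1 - q))))) ^ M"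

end

theory Submission
  imports Defs "HOL-Complex_Analysis.Complex_Analysis"
begin

text \<open>Put \<open>a = N - \<lfloor>qN\<rfloor>\<close>, so that \<open>N |u_N|\<^sup>2 = a\<close>, and \<open>\<beta> = \<gamma> / (1 - q) = lim M / a\<close>. After the
  contour of the weight is moved to the line through \<open>a\<close>, the quantity
  \<open>w(z) |z|\<^bsup>2a\<^esup> / \<Gamma>(a)\<^bsup>M\<^esup>\<close> becomes the Fourier integral of \<open>(\<Gamma>(a + it) / \<Gamma>(a))\<^bsup>M\<^esup>\<close>. Up to a phase of
  frequency \<open>M log a\<close> this integrand converges to \<open>exp (- \<beta> (t\<^sup>2 + it) / 2)\<close> and is dominated by a
  Lorentzian, so the weight has a Gaussian limit. In the sum over \<open>j\<close> the
  term \<open>j = a - 1 + i\<close>, divided by the term \<open>j = a - 1\<close>, converges to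
  \<open>exp (i (v\<^sub>1 + cnj v\<^sub>2) - \<beta> i\<^sup>2 / 2)\<close>; here \<open>i\<close> ranges up to \<open>N - a = \<lfloor>qN\<rfloor>\<close>, which tends to infinity
  in the bulk and is 0 at the edge. The remaining factors are phases \<open>p(v\<^sub>1) cnj (p(v\<^sub>2))\<close>, which
  cancel in the determinant.\<close>

section \<open>Determinants and uniform limits\<close>

text \<open>The logarithm of Gamma(a + it) / Gamma(a) is multiplied by M, which is of order a, so it
  must be known up to o(1/a). Instead of a complex Stirling formula, the ratio, freed of its phase,
  is written exactly as the exponential of minus a tail sum of increments asymptotic to a constant
  over k^2; only the 1/a term of that tail survives. The same order of precision explains the shift
  \<gamma>/(4(1-q)) = \<beta>/4 in z_j. Second-order terms leave a spare \<beta>/2: in the weight as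
  a linear phase, in the sum as the difference between m(m+1)/2 and m^2/2. Both are compensated by
  two copies of \<beta>/4, since the weight sees |z|^2 and the sum sees z_1 times the conjugate of
  z_2. The line through a is natural because the saddle point of Gamma(s)^M |z|^(-2s) stays at
  bounded distance from a. Uniformity in v is never estimated. It is deduced from convergence along
  all subsequences and all convergent sequences of points, so every limit below is taken with a
  moving argument.\<close>

lemma det_scale_rows_cols:
  fixes A :: "nat \<Rightarrow> nat \<Rightarrow> complex"
  shows "Determinant.det (mat n n (\<lambda>(i, j). d i * A i j * e j)) =
         (\<Prod>i<n. d i * e i) * Determinant.det (mat n n (\<lambda>(i, j). A i j))"
proof -
  have perm: "(\<Prod>i=0..<n. e (p i)) = (\<Prod>i=0..<n. e i)" if "p permutes {0..<n}" for p
    using prod.permute[OF that, of e] by (simp add: o_def)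
  have entry: "(\<Prod>i=0..<n. mat n n (\<lambda>(i, j). B i j) $$ (i, p i)) = (\<Prod>i=0..<n. B i (p i))"
    if "p permutes {0..<n}" for p and B :: "nat \<Rightarrow> nat \<Rightarrow> complex"
    using permutes_in_image[OF that] by (intro prod.cong) auto
  have "Determinant.det (mat n n (\<lambda>(i, j). d i * A i j * e j)) =
      (\<Sum>p\<in>{p. p permutes {0..<n}}. signof p * (\<Prod>i=0..<n. d i * A i (p i) * e (p i)))"
    by (subst det_def'[of _ n]) (auto intro!: sum.cong simp: entry)
  also have "\<dots> = (\<Sum>p\<in>{p. p permutes {0..<n}}.
      (\<Prod>i<n. d i * e i) * (signof p * (\<Prod>i=0..<n. A i (p i))))"
    by (intro sum.cong refl) (auto simp: prod.distrib perm lessThan_atLeast0 mult_ac)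
  also have "\<dots> = (\<Prod>i<n. d i * e i) * Determinant.det (mat n n (\<lambda>(i, j). A i j))"
    by (subst det_def'[of _ n]) (auto intro!: sum.cong simp: entry sum_distrib_left)
  finally show ?thesis .
qed

lemma tendsto_det:
  fixes A :: "'a \<Rightarrow> nat \<Rightarrow> nat \<Rightarrow> complex"
  assumes "\<And>i j. i < n \<Longrightarrow> j < n \<Longrightarrow> ((\<lambda>k. A k i j) \<longlongrightarrow> B i j) F"
  shows "((\<lambda>k. Determinant.det (mat n n (\<lambda>(i, j). A k i j))) \<longlongrightarrow>
           Determinant.det (mat n n (\<lambda>(i, j). B i j))) F"
proof -
  have eq: "Determinant.det (mat n n (\<lambda>(i, j). B i j)) =
      (\<Sum>p\<in>{p. p permutes {0..<n}}. signof p * (\<Prod>i=0..<n. B i (p i)))"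
    for B :: "nat \<Rightarrow> nat \<Rightarrow> complex"
    using permutes_in_image[of _ "{0..<n}"]
    by (subst det_def'[of _ n]) (auto intro!: sum.cong prod.cong)
  show ?thesis
    unfolding eq using permutes_in_image[of _ "{0..<n}"] by (intro tendsto_intros assms) auto
qed

section \<open>Uniform convergence through sequential compactness\<close>

text \<open>Points are functions constrained only below \<open>n\<close>, so compactness is
  exploited one coordinate at a time, each step thinning the previous subsequence.\<close>

lemma bounded_coordinates_convergent_subseq:
  fixes v :: "nat \<Rightarrow> nat \<Rightarrow> 'a::metric_space"
  assumes "compact C" "\<And>k i. i < n \<Longrightarrow> v k i \<in> C"
  shows "\<exists>r l. strict_mono r \<and> (\<forall>i<n. l i \<in> C \<and> (\<lambda>k. v (r k) i) \<longlonglongrightarrow> l i)"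
  using assms(2)
proof (induction n)
  case 0
  then show ?case by (auto intro!: exI[of _ id] simp: strict_mono_id)
next
  case (Suc n)
  from Suc obtain r l where r: "strict_mono r"
    and l: "\<forall>i<n. l i \<in> C \<and> (\<lambda>k. v (r k) i) \<longlonglongrightarrow> l i" by (metis less_SucI)
  have "\<forall>k. v (r k) n \<in> C" using Suc by auto
  then obtain m s where m: "m \<in> C" and s: "strict_mono s" "((\<lambda>k. v (r k) n) \<circ> s) \<longlonglongrightarrow> m"
    using assms(1) unfolding compact_def by metis
  have "\<forall>i<Suc n. (l(n:=m)) i \<in> C \<and> (\<lambda>k. v ((r \<circ> s) k) i) \<longlonglongrightarrow> (l(n:=m)) i"
    using l m s(2) LIMSEQ_subseq_LIMSEQ[OF _ s(1)] by (auto simp: less_Suc_eq o_def)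
  then show ?case using strict_mono_o[OF r s(1)] by blast
qed

text \<open>Continuity of the limit function is a consequence of the hypothesis: approximate
  \<open>g (v k)\<close> by \<open>f (m k) (v k)\<close> with a rapidly increasing \<open>m\<close>.\<close>

lemma uniform_limit_from_continuous_convergence:
  fixes f :: "nat \<Rightarrow> (nat \<Rightarrow> 'a::metric_space) \<Rightarrow> 'b::metric_space"
  assumes C: "compact C"
    and conv: "\<And>\<sigma> v l. strict_mono \<sigma> \<Longrightarrow> (\<And>k i. i < n \<Longrightarrow> v k i \<in> C) \<Longrightarrow> (\<And>i. i < n \<Longrightarrow> l i \<in> C) \<Longrightarrow>
          (\<And>i. i < n \<Longrightarrow> (\<lambda>k. v k i) \<longlonglongrightarrow> l i) \<Longrightarrow> (\<lambda>k. f (\<sigma> k) (v k)) \<longlonglongrightarrow> g l"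
  shows "uniform_limit {v. \<forall>i<n. v i \<in> C} f g sequentially"
proof (rule ccontr)
  let ?S = "{v. \<forall>i<n. v i \<in> C}"
  assume "\<not> uniform_limit ?S f g sequentially"
  then obtain e where e: "e > 0" and "\<not> (\<forall>\<^sub>F k in sequentially. \<forall>x\<in>?S. dist (f k x) (g x) < e)"
    unfolding uniform_limit_iff by blast
  then have "\<forall>m. \<exists>k\<ge>m. \<exists>x\<in>?S. dist (f k x) (g x) \<ge> e"
    unfolding eventually_sequentially by (meson not_less)
  moreover define K where "K = {k. \<exists>x\<in>?S. dist (f k x) (g x) \<ge> e}"
  ultimately have "infinite K"
    unfolding infinite_nat_iff_unbounded_le by blast
  then obtain \<sigma> :: "nat \<Rightarrow> nat" where \<sigma>: "strict_mono \<sigma>" "\<And>k. \<sigma> k \<in> K"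
    using infinite_enumerate by blast
  define v where "v k = (SOME x. x \<in> ?S \<and> dist (f (\<sigma> k) x) (g x) \<ge> e)" for k
  have ex: "\<exists>x. x \<in> ?S \<and> dist (f (\<sigma> k) x) (g x) \<ge> e" for k
    using \<sigma>(2)[of k] by (auto simp: K_def)
  have "v k \<in> ?S \<and> dist (f (\<sigma> k) (v k)) (g (v k)) \<ge> e" for k
    unfolding v_def by (rule someI_ex[OF ex])
  then have v: "\<And>k. v k \<in> ?S" "\<And>k. dist (f (\<sigma> k) (v k)) (g (v k)) \<ge> e" by blast+
  then obtain r l where r: "strict_mono r"
      and l: "\<forall>i<n. l i \<in> C \<and> (\<lambda>k. v (r k) i) \<longlonglongrightarrow> l i"
    using bounded_coordinates_convergent_subseq[OF C, of n v] by auto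
  define w where "w = v \<circ> r"
  have w: "w k i \<in> C" if "i < n" for k i using v(1) that by (auto simp: w_def)
  have wl: "(\<lambda>k. w k i) \<longlonglongrightarrow> l i" if "i < n" for i using l that by (auto simp: w_def)
  have f_lim: "(\<lambda>k. f ((\<sigma> \<circ> r) k) (w k)) \<longlonglongrightarrow> g l"
    using l w wl by (intro conv strict_mono_o \<sigma>(1) r) auto
  \<comment> \<open>A constant sequence of points turns \<open>conv\<close> into pointwise
    convergence, so \<open>g (w k)\<close> is approximated by values of \<open>f\<close> at
    arbitrarily late stages.\<close>
  have "(\<lambda>m. f (id m) (w k)) \<longlonglongrightarrow> g (w k)" for k
    by (rule conv) (use w in \<open>auto simp: strict_mono_id\<close>)
  then have close: "\<exists>m\<ge>m0. dist (f m (w k)) (g (w k)) < 1 / real (Suc k)" for k m0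
    unfolding lim_sequentially id_def by (metis nat_le_linear of_nat_0_less_iff zero_less_Suc zero_less_divide_1_iff)
  \<comment> \<open>The stages are chosen strictly increasing, because \<open>conv\<close> applies
    only along such index sequences.\<close>
  have "\<exists>m. \<forall>k. dist (f (m k) (w k)) (g (w k)) < 1 / real (Suc k) \<and> m k < m (Suc k)"
    by (rule dependent_nat_choice) (use close in \<open>meson Suc_le_lessD\<close>)+
  then obtain m where m: "\<And>k. dist (f (m k) (w k)) (g (w k)) < 1 / real (Suc k)"
      and "\<And>k. m k < m (Suc k)" by blast
  then have mono: "strict_mono m" by (simp add: strict_mono_Suc_iff)
  have "(\<lambda>k. f (m k) (w k)) \<longlonglongrightarrow> g l"
    using l w wl by (intro conv mono) auto
  moreover have "(\<lambda>k. dist (f (m k) (w k)) (g (w k))) \<longlonglongrightarrow> 0"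
  proof (rule tendsto_sandwich[OF _ _ tendsto_const LIMSEQ_inverse_real_of_nat])
    show "\<forall>\<^sub>F k in sequentially. dist (f (m k) (w k)) (g (w k)) \<le> inverse (real (Suc k))"
      using m by (auto intro!: always_eventually less_imp_le simp: inverse_eq_divide)
  qed simp
  ultimately have "(\<lambda>k. dist (f (m k) (w k)) (g (w k)) + dist (f (m k) (w k)) (g l)) \<longlonglongrightarrow> 0 + 0"
    by (intro tendsto_add tendsto_dist_iff[THEN iffD1])
  then have sum0: "(\<lambda>k. dist (f (m k) (w k)) (g (w k)) + dist (f (m k) (w k)) (g l)) \<longlonglongrightarrow> 0"
    by simp
  have "(\<lambda>k. dist (g (w k)) (g l)) \<longlonglongrightarrow> 0"
    by (rule tendsto_sandwich[OF _ _ tendsto_const sum0]) (auto intro!: always_eventually dist_triangle3)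
  then have g_lim: "(\<lambda>k. g (w k)) \<longlonglongrightarrow> g l"
    by (rule tendsto_dist_iff[THEN iffD2])
  have "(\<lambda>k. dist (f ((\<sigma> \<circ> r) k) (w k)) (g (w k))) \<longlonglongrightarrow> 0"
    using tendsto_dist[OF f_lim g_lim] by simp
  then have "\<forall>\<^sub>F k in sequentially. dist (f ((\<sigma> \<circ> r) k) (w k)) (g (w k)) < e"
    using e by (rule order_tendstoD)
  then show False using v(2) by (auto simp: w_def not_less[symmetric] eventually_sequentially)
qed

section \<open>The weight as a vertical line integral\<close>

text \<open>In the approximation n^z n! / (z (z+1) ... (z+n)) an imaginary part leaves |n^z|
  unchanged and only enlarges the moduli of the factors in the denominator.\<close>

lemma norm_Gamma_le:
  assumes x: "x > 0"
  shows "norm (Gamma (Complex x t)) \<le> Gamma x"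
proof (rule LIMSEQ_le)
  show "(\<lambda>n. norm (Gamma_series (Complex x t) n)) \<longlonglongrightarrow> norm (Gamma (Complex x t))"
    by (intro tendsto_intros)
  show "Gamma_series x \<longlonglongrightarrow> Gamma x"
    by (rule Gamma_series_LIMSEQ)
  show "\<exists>N. \<forall>n\<ge>N. norm (Gamma_series (Complex x t) n) \<le> Gamma_series x n"
  proof (intro exI allI impI)
    fix n :: nat
    have "pochhammer x (n + 1) \<le> norm (pochhammer (Complex x t) (n + 1))"
      unfolding pochhammer_prod prod_norm[symmetric] using x
      by (intro prod_mono) (auto intro!: order_trans[OF _ complex_Re_le_cmod])
    then show "norm (Gamma_series (Complex x t) n) \<le> Gamma_series x n"
      using x by (auto simp: Gamma_series_def norm_mult norm_divide intro!: frac_le pochhammer_pos)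
  qed
qed

text \<open>All decay in t comes from the functional equation: m steps to the right produce the
  product, and at x + m the trivial bound suffices. Later m is 2, for integrability, and 2a, for a
  bound uniform in a.\<close>

lemma norm_Gamma_mult_prod_le:
  assumes x: "x > 0"
  shows "norm (Gamma (Complex x t)) * (\<Prod>k<m. norm (Complex (x + real k) t)) \<le> Gamma (x + real m)"
proof -
  have nz: "Complex x t \<notin> \<int>\<^sub>\<le>\<^sub>0"
    using x by (auto elim!: nonpos_Ints_cases simp: complex_eq_iff)
  have shift: "Complex x t + of_nat k = Complex (x + real k) t" for k
    by (simp add: complex_eq_iff)
  have "pochhammer (Complex x t) m * Gamma (Complex x t) = Gamma (Complex (x + real m) t)"
    using pochhammer_Gamma[OF nz, of m] Gamma_nonzero[OF nz] by (simp add: shift)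
  then have "norm (pochhammer (Complex x t) m) * norm (Gamma (Complex x t)) =
      norm (Gamma (Complex (x + real m) t))"
    by (metis norm_mult)
  moreover have "norm (pochhammer (Complex x t) m) = (\<Prod>k<m. norm (Complex (x + real k) t))"
    by (simp add: pochhammer_prod prod_norm[symmetric] shift lessThan_atLeast0)
  ultimately show ?thesis
    using norm_Gamma_le[of "x + real m" t] x by (simp add: mult.commute)
qed

text \<open>One step of the functional equation would only give 1/|t|, which is not integrable; two
  give 1/t^2. The summand \<open>Gamma x\<close> covers small t.\<close>

lemma norm_Gamma_vertical_le:
  assumes x: "x > 0"
  shows "norm (Gamma (Complex x t)) \<le> (Gamma x + Gamma (x + 2)) / (1 + t\<^sup>2)"
proof -
  have "\<bar>t\<bar> * \<bar>t\<bar> \<le> norm (Complex x t) * norm (Complex (x + 1) t)"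
    using abs_Im_le_cmod[of "Complex x t"] abs_Im_le_cmod[of "Complex (x + 1) t"]
    by (intro mult_mono) auto
  then have "norm (Gamma (Complex x t)) * t\<^sup>2 \<le>
      norm (Gamma (Complex x t)) * (norm (Complex x t) * norm (Complex (x + 1) t))"
    by (intro mult_left_mono) (auto simp: power2_eq_square)
  also have "\<dots> \<le> Gamma (x + 2)"
    using norm_Gamma_mult_prod_le[OF x, of t 2] by (simp add: numeral_2_eq_2 mult_ac)
  finally have "norm (Gamma (Complex x t)) * (1 + t\<^sup>2) \<le> Gamma x + Gamma (x + 2)"
    using norm_Gamma_le[OF x, of t] by (simp add: algebra_simps)
  then show ?thesis
    by (subst pos_le_divide_eq) (auto simp: add_pos_nonneg)
qed

section \<open>Moving the contour of the weight\<close>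

lemma integrable_Cauchy_density: "integrable lborel (\<lambda>t::real. B / (1 + t\<^sup>2))"
  using integrable_inverse_1_plus_square
  by (simp add: set_integrable_def einterval_def divide_inverse integrable_mult_right)

lemma LIMSEQ_integral_symmetric:
  fixes f :: "real \<Rightarrow> 'a::{banach, second_countable_topology}"
  assumes "integrable lborel f"
  shows "(\<lambda>n. \<integral>t. indicator {- real n..real n} t *\<^sub>R f t \<partial>lborel) \<longlonglongrightarrow> (\<integral>t. f t \<partial>lborel)"
proof (rule integral_dominated_convergence[where w = "\<lambda>t. norm (f t)"])
  show "AE t in lborel. (\<lambda>n. indicator {- real n..real n} t *\<^sub>R f t) \<longlonglongrightarrow> f t"
  proof (rule AE_I2)
    fix t :: real
    have "\<forall>\<^sub>F n in sequentially. real n \<ge> \<bar>t\<bar>"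
      by (rule eventually_at_top_linorderI[of "nat \<lceil>\<bar>t\<bar>\<rceil>"]) linarith
    then have "\<forall>\<^sub>F n in sequentially. indicator {- real n..real n} t *\<^sub>R f t = f t"
      by eventually_elim (auto simp: indicator_def)
    then show "(\<lambda>n. indicator {- real n..real n} t *\<^sub>R f t) \<longlonglongrightarrow> f t"
      by (rule tendsto_eventually)
  qed
qed (use assms in \<open>auto simp: indicator_def\<close>)

text \<open>The holomorphic integrand has a primitive on the half-plane, so the difference of the two
  integrals over \<open>[-T, T]\<close> is a difference of values of the primitive at the ends of two short
  horizontal segments, on which the integrand is small.\<close>

lemma integral_vertical_line_shift:
  fixes f :: "complex \<Rightarrow> complex"
  assumes holo: "f holomorphic_on {s. Re s > 0}" and a: "0 < a" "a \<le> b"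
    and bound: "\<And>x t. a \<le> x \<Longrightarrow> x \<le> b \<Longrightarrow> norm (f (Complex x t)) \<le> B / (1 + t\<^sup>2)"
  shows "(\<integral>t. f (Complex a t) \<partial>lborel) = (\<integral>t. f (Complex b t) \<partial>lborel)"
proof -
  define S where "S = {s. Re s > 0}"
  have S: "convex S" "open S" unfolding S_def by (rule convex_halfspace_Re_gt open_halfspace_Re_gt)+
  obtain H where H: "\<And>s. s \<in> S \<Longrightarrow> (H has_field_derivative f s) (at s within S)"
    using holomorphic_convex_primitive'[OF S] holo unfolding S_def by blast
  have H': "(H has_field_derivative f s) (at s within T)" if "Re s > 0" for s T
  proof -
    have "s \<in> S" using that by (simp add: S_def)
    then show ?thesis
      using H[of s] at_within_open[of s S] S(2) by (auto intro: has_field_derivative_at_within)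
  qed
  have line: "Complex x = (\<lambda>t. of_real x + \<i> * of_real t)" for x
    by (auto simp: complex_eq_iff)
  have cont: "continuous_on UNIV (\<lambda>t. f (Complex x t))" if "x > 0" for x
    unfolding line
    by (rule continuous_on_compose2[OF holomorphic_on_imp_continuous_on[OF holo]])
       (use that in \<open>auto intro!: continuous_intros\<close>)
  have int: "integrable lborel (\<lambda>t. f (Complex x t))" if "a \<le> x" "x \<le> b" for x
  proof (rule Bochner_Integration.integrable_bound[OF integrable_Cauchy_density[of B]])
    show "(\<lambda>t. f (Complex x t)) \<in> borel_measurable lborel"
      using borel_measurable_continuous_onI[OF cont[of x]] a that by simp
    have "norm (f (Complex x t)) \<le> norm (B / (1 + t\<^sup>2))" for t
      unfolding real_norm_def by (rule order_trans[OF bound[OF that] abs_ge_self])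
    then show "AE t in lborel. norm (f (Complex x t)) \<le> norm (B / (1 + t\<^sup>2))" by simp
  qed
  \<comment> \<open>Along the line ds = i dt, so the antiderivative with respect to t is
    \<open>- \<i> * H\<close>.\<close>
  have FTC: "(\<integral>t. indicator {- real n..real n} t *\<^sub>R f (Complex x t) \<partial>lborel) =
      - \<i> * H (Complex x (real n)) - - \<i> * H (Complex x (- real n))" if x: "a \<le> x" "x \<le> b" for x n
  proof (rule integral_FTC_Icc)
    fix t
    have "(Complex x has_vector_derivative \<i>) (at t within {- real n..real n})"
      unfolding line by (auto intro!: derivative_eq_intros)
    from field_vector_diff_chain_within[OF this H'[of "Complex x t"]]
    have "((\<lambda>t. H (Complex x t)) has_vector_derivative \<i> * f (Complex x t)) (at t within {- real n..real n})"
      using a x by (auto simp: o_def)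
    from has_vector_derivative_mult_right[OF this, of "- \<i>"]
    show "((\<lambda>t. - \<i> * H (Complex x t)) has_vector_derivative f (Complex x t)) (at t within {- real n..real n})"
      by (simp add: mult.assoc[symmetric])
  qed (use a x cont[of x] in \<open>auto intro: continuous_on_subset\<close>)
  have seg: "norm (H (Complex a t) - H (Complex b t)) \<le> B / (1 + t\<^sup>2) * (b - a)" for t
  proof -
    have "norm (H (Complex a t) - H (Complex b t)) \<le> B / (1 + t\<^sup>2) * norm (Complex a t - Complex b t)"
    proof (rule field_differentiable_bound[where S = "closed_segment (Complex a t) (Complex b t)" and f' = f])
      fix s assume s: "s \<in> closed_segment (Complex a t) (Complex b t)"
      then have "Re s \<in> closed_segment a b" "Im s = t"
        by (auto simp: closed_segment_same_Im)
      then have "a \<le> Re s" "Re s \<le> b" "s = Complex (Re s) t"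
        using a by (auto simp: closed_segment_eq_real_ivl complex_eq_iff)
      then show "(H has_field_derivative f s) (at s within closed_segment (Complex a t) (Complex b t))"
        and "norm (f s) \<le> B / (1 + t\<^sup>2)"
        using a bound[of "Re s" t] by (auto intro!: H')
    qed auto
    also have "norm (Complex a t - Complex b t) = b - a"
      using a by (simp add: complex_norm complex_diff)
    finally show ?thesis .
  qed
  let ?I = "\<lambda>x n. \<integral>t. indicator {- real n..real n} t *\<^sub>R f (Complex x t) \<partial>lborel"
  have le: "norm (?I a n - ?I b n) \<le> 2 * B * (b - a) / (1 + (real n)\<^sup>2)" for n
  proof -
    have "?I a n - ?I b n = - \<i> * (H (Complex a (real n)) - H (Complex b (real n)))
        + \<i> * (H (Complex a (- real n)) - H (Complex b (- real n)))"
      using a by (simp add: FTC algebra_simps)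
    also have "norm \<dots> \<le> B / (1 + (real n)\<^sup>2) * (b - a) + B / (1 + (- real n)\<^sup>2) * (b - a)"
      by (rule norm_triangle_le)
         (intro add_mono; simp only: norm_mult norm_minus_cancel norm_ii mult_1_left seg)
    finally show ?thesis by (simp add: field_simps)
  qed
  have "(\<lambda>n. 2 * B * (b - a) / (1 + (real n)\<^sup>2)) \<longlonglongrightarrow> 0"
    by real_asymp
  then have "(\<lambda>n. ?I a n - ?I b n) \<longlonglongrightarrow> 0"
    by (rule Lim_null_comparison[OF always_eventually, rotated]) (use le in auto)
  moreover have "(\<lambda>n. ?I a n - ?I b n) \<longlonglongrightarrow>
      (\<integral>t. f (Complex a t) \<partial>lborel) - (\<integral>t. f (Complex b t) \<partial>lborel)"
    using a by (intro tendsto_diff LIMSEQ_integral_symmetric int) auto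
  ultimately show ?thesis
    using LIMSEQ_unique by fastforce
qed

lemma holomorphic_ginibre_integrand:
  "(\<lambda>s. Gamma s ^ M * exp (- s * of_real l)) holomorphic_on {s. Re s > 0}"
proof -
  have "s \<notin> \<int>\<^sub>\<le>\<^sub>0" if "Re s > 0" for s using that by (auto elim!: nonpos_Ints_cases)
  then show ?thesis by (intro holomorphic_intros) auto
qed

text \<open>The real parts between the two lines form a compact interval, on which
  \<open>Gamma x + Gamma (x + 2)\<close> is bounded; this makes the bound in t uniform over the
  strip.\<close>

lemma integral_ginibre_integrand_shift:
  assumes "0 < a" "a \<le> b" and M: "M \<ge> 1"
  shows "(\<integral>t. Gamma (Complex a t) ^ M * exp (- Complex a t * of_real l) \<partial>lborel) =
         (\<integral>t. Gamma (Complex b t) ^ M * exp (- Complex b t * of_real l) \<partial>lborel)"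
proof -
  have "continuous_on {a..b} (\<lambda>x. Gamma x + Gamma (x + 2))"
    using assms
    by (intro continuous_on_add continuous_on_Gamma
          continuous_on_compose2[OF continuous_on_Gamma, of "{0<..}" _ "\<lambda>x. x + 2"] continuous_intros)
       (auto elim!: nonpos_Ints_cases)
  then have "bounded ((\<lambda>x. Gamma x + Gamma (x + 2)) ` {a..b})"
    by (intro compact_imp_bounded compact_continuous_image) auto
  then obtain D where D: "\<And>x. x \<in> {a..b} \<Longrightarrow> \<bar>Gamma x + Gamma (x + 2)\<bar> \<le> D"
    unfolding bounded_iff by (force simp: image_iff)
  then have D0: "D \<ge> 0"
    using assms by (intro order_trans[OF abs_ge_zero D[of a]]) auto
  have "norm (Gamma (Complex x t) ^ M * exp (- Complex x t * of_real l)) \<le>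
      D ^ M * exp (b * \<bar>l\<bar>) / (1 + t\<^sup>2)" if x: "a \<le> x" "x \<le> b" for x t
  proof -
    have "norm (Gamma (Complex x t)) \<le> (Gamma x + Gamma (x + 2)) / (1 + t\<^sup>2)"
      using assms x by (intro norm_Gamma_vertical_le) auto
    also have "\<dots> \<le> D / (1 + t\<^sup>2)"
      using D[of x] x by (intro divide_right_mono) auto
    finally have "norm (Gamma (Complex x t)) ^ M \<le> (D / (1 + t\<^sup>2)) ^ M"
      by (intro power_mono) auto
    also have "\<dots> = D ^ M / (1 + t\<^sup>2) ^ M" by (rule power_divide)
    \<comment> \<open>One factor 1/(1 + t^2) is kept for integrability, the others being at most 1;
      this is where M >= 1 enters.\<close>
    also have "\<dots> \<le> D ^ M / (1 + t\<^sup>2) ^ 1"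
      using M D0 by (intro divide_left_mono power_increasing) (auto simp: add_pos_nonneg)
    finally have G: "norm (Gamma (Complex x t)) ^ M \<le> D ^ M / (1 + t\<^sup>2)" by simp
    have "- x * l \<le> b * \<bar>l\<bar>"
    proof -
      have "- x * l \<le> \<bar>- x * l\<bar>" by (rule abs_ge_self)
      also have "\<dots> = x * \<bar>l\<bar>" using x assms by (simp add: abs_mult)
      also have "\<dots> \<le> b * \<bar>l\<bar>" using x by (intro mult_right_mono) auto
      finally show ?thesis .
    qed
    then have "norm (Gamma (Complex x t)) ^ M * exp (- x * l) \<le> D ^ M / (1 + t\<^sup>2) * exp (b * \<bar>l\<bar>)"
      using G D0 by (intro mult_mono) auto
    then show ?thesis by (simp add: norm_mult norm_power)
  qed
  then show ?thesis
    using assms by (intro integral_vertical_line_shift[OF holomorphic_ginibre_integrand])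
qed

text \<open>On the line Re s = a the factor |z|^(-2s) has constant modulus |z|^(-2a). Normalizing
  removes it and divides Gamma by its value at t = 0; there remain a power that equals 1 at t = 0
  and a pure oscillation of frequency 2 ln |z|.\<close>

lemma ginibre_weight_scaled:
  fixes a :: nat
  assumes c: "c > 0" and a: "a \<ge> 1" and M: "M \<ge> 1" and z: "z \<noteq> 0"
  shows "ginibre_weight c M z * of_real (cmod z ^ (2 * a) / Gamma (real a) ^ M) =
    (\<integral>t. (Gamma (Complex (real a) t) / of_real (Gamma (real a))) ^ M *
          exp (- \<i> * of_real (t * (2 * ln (cmod z)))) \<partial>lborel) / of_real (2 * pi)"
proof -
  define l where "l = 2 * ln (cmod z)"
  define G where "G = (\<lambda>s::complex. Gamma s ^ M * exp (- s * of_real l))"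
  \<comment> \<open>The weight evaluates Gamma at -s, hence on the line through c traversed
    downwards. The argument is kept as the affine map t -> 0 + (-1) t, to be undone by
    substitution.\<close>
  have "ginibre_weight c M z = (\<integral>t. G (Complex c (0 + (-1) * t)) / of_real (2 * pi) \<partial>lborel)"
    unfolding ginibre_weight_def Let_def
  proof (intro Bochner_Integration.integral_cong refl)
    fix t
    have minus: "- Complex (- c) t = Complex c (0 + (-1) * t)" by (simp add: complex_eq_iff)
    have "complex_of_real (cmod z) powr (2 * Complex (- c) t) = exp (- Complex c (0 + (-1) * t) * of_real l)"
      using z unfolding minus[symmetric] by (simp add: powr_def Ln_of_real l_def mult_ac)
    then show "Gamma (- Complex (- c) t) ^ M * complex_of_real (cmod z) powr (2 * Complex (- c) t) /
        (2 * complex_of_real pi * \<i>) * \<i> = G (Complex c (0 + (-1) * t)) / of_real (2 * pi)"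
      unfolding G_def minus by (simp add: field_simps)
  qed
  also have "\<dots> = (\<integral>t. G (Complex c (0 + (-1) * t)) \<partial>lborel) / of_real (2 * pi)"
    by simp
  also have "(\<integral>t. G (Complex c (0 + (-1) * t)) \<partial>lborel) = (\<integral>t. G (Complex c t) \<partial>lborel)"
    using lborel_integral_real_affine[of "-1" "\<lambda>t. G (Complex c t)" 0] by simp
  also have "\<dots> = (\<integral>t. G (Complex (real a) t) \<partial>lborel)"
  proof (cases "c \<le> real a")
    case True
    show ?thesis unfolding G_def by (rule integral_ginibre_integrand_shift[OF c True M])
  next
    case False
    then have "real a \<le> c" "0 < real a" using a by auto
    from integral_ginibre_integrand_shift[OF this(2,1) M] show ?thesis
      unfolding G_def by (rule sym)
  qed
  finally have w: "ginibre_weight c M z = (\<integral>t. G (Complex (real a) t) \<partial>lborel) / of_real (2 * pi)" .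
  have "exp (real a * l) = exp l ^ a" by (rule exp_of_nat_mult)
  also have "exp l = (cmod z)\<^sup>2" using z by (simp add: l_def exp_double)
  finally have za: "complex_of_real (cmod z ^ (2 * a)) = exp (of_real (real a * l))"
    by (simp only: exp_of_real power_mult)
  have G: "G (Complex (real a) t) * of_real (cmod z ^ (2 * a) / Gamma (real a) ^ M) =
      (Gamma (Complex (real a) t) / of_real (Gamma (real a))) ^ M * exp (- \<i> * of_real (t * l))" for t
  proof -
    have "exp (- Complex (real a) t * of_real l) * complex_of_real (cmod z ^ (2 * a)) =
        exp (- \<i> * of_real (t * l))"
      unfolding za exp_add[symmetric] by (rule arg_cong[of _ _ exp]) (simp add: complex_eq_iff)
    then show ?thesis
      unfolding G_def by (simp add: power_mult_distrib power_inverse divide_inverse mult_ac)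
  qed
  have "(\<integral>t. G (Complex (real a) t) \<partial>lborel) * of_real (cmod z ^ (2 * a) / Gamma (real a) ^ M) =
      (\<integral>t. G (Complex (real a) t) * of_real (cmod z ^ (2 * a) / Gamma (real a) ^ M) \<partial>lborel)"
    by (rule integral_mult_left_zero[symmetric])
  then show ?thesis
    unfolding w l_def[symmetric] G by (simp only: times_divide_eq_left)
qed

section \<open>Asymptotics of Gamma ratios\<close>

text \<open>Provides a dominating function as long as M/a stays bounded below. A fixed number of
  steps of the functional equation gains too little for large a, so 2a steps are taken. For k < 2a
  one has a + k <= 3a, whence |a + k + it| >= (a + k) sqrt (1 + y) with y = t^2/(9 a^2). The 2a
  square roots multiply to (1 + y)^a, and Bernoulli's inequality with exponent aM gives M
  t^2/(9a).\<close>

lemma Gamma_ratio_power_le: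
  fixes a M :: nat
  assumes a: "a \<ge> 1"
  shows "norm (Gamma (Complex (real a) t) / of_real (Gamma (real a))) ^ M
           \<le> 1 / (1 + real M * t\<^sup>2 / (9 * real a))"
proof -
  define y where "y = t\<^sup>2 / (9 * (real a)\<^sup>2)"
  define r where "r = norm (Gamma (Complex (real a) t) / of_real (Gamma (real a)))"
  have y: "y \<ge> 0" by (simp add: y_def)
  have pos: "Gamma (real a) > 0" using a by (intro Gamma_real_pos) auto
  have factor: "(real a + real k) * sqrt (1 + y) \<le> norm (Complex (real a + real k) t)"
    if k: "k < 2 * a" for k
  proof -
    have "(real a + real k)\<^sup>2 * y \<le> (3 * real a)\<^sup>2 * y"
      using k y by (intro mult_right_mono power_mono) auto
    also have "\<dots> = t\<^sup>2" using a by (simp add: y_def power_mult_distrib)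
    finally have "sqrt ((real a + real k)\<^sup>2 * (1 + y)) \<le> sqrt ((real a + real k)\<^sup>2 + t\<^sup>2)"
      by (simp add: algebra_simps)
    then show ?thesis by (simp add: real_sqrt_mult complex_norm)
  qed
  have "real a \<notin> \<int>\<^sub>\<le>\<^sub>0" using nonpos_Ints_nonpos[of "real a"] a by auto
  from pochhammer_Gamma[OF this, of "2 * a"]
  have "pochhammer (real a) (2 * a) * Gamma (real a) = Gamma (real a + real (2 * a))"
    using nonzero_eq_divide_eq[OF less_imp_neq[OF pos, symmetric]] by blast
  then have "Gamma (real a) * pochhammer (real a) (2 * a) = Gamma (real a + real (2 * a))"
    by (simp only: mult.commute)
  moreover have "pochhammer (real a) (2 * a) * (1 + y) ^ a = (\<Prod>k<2 * a. (real a + real k) * sqrt (1 + y))"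
    using y by (simp add: prod.distrib pochhammer_prod lessThan_atLeast0 power_mult)
  moreover have "\<dots> \<le> (\<Prod>k<2 * a. norm (Complex (real a + real k) t))"
    using y by (intro prod_mono) (auto intro!: factor)
  moreover have "norm (Gamma (Complex (real a) t)) * (\<Prod>k<2 * a. norm (Complex (real a + real k) t))
      \<le> Gamma (real a + real (2 * a))"
    using a by (intro norm_Gamma_mult_prod_le) auto
  ultimately have "norm (Gamma (Complex (real a) t)) * (pochhammer (real a) (2 * a) * (1 + y) ^ a)
      \<le> Gamma (real a) * pochhammer (real a) (2 * a)"
    by (metis (no_types, lifting) mult_left_mono norm_ge_zero order_trans)
  then have "norm (Gamma (Complex (real a) t)) * (1 + y) ^ a \<le> Gamma (real a)"
    using pochhammer_pos[of "real a" "2 * a"] a by (simp add: mult_ac)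
  then have "r * (1 + y) ^ a \<le> 1"
    using pos by (simp add: r_def norm_divide field_simps)
  then have "(r * (1 + y) ^ a) ^ M \<le> 1"
    using y by (intro power_le_one) (auto simp: r_def)
  then have "r ^ M * (1 + y) ^ (a * M) \<le> 1"
    by (simp add: power_mult_distrib power_mult)
  moreover have "r ^ M * (1 + real (a * M) * y) \<le> r ^ M * (1 + y) ^ (a * M)"
    using y by (intro mult_left_mono Bernoulli_inequality) (auto simp: r_def)
  ultimately have "r ^ M * (1 + real (a * M) * y) \<le> 1" by linarith
  moreover have "real (a * M) * y = real M * t\<^sup>2 / (9 * real a)"
    using a by (simp add: y_def field_simps power2_eq_square)
  moreover have "1 + real M * t\<^sup>2 / (9 * real a) > 0"
    by (simp add: add_pos_nonneg)
  ultimately show ?thesis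
    by (simp add: r_def pos_le_divide_eq)
qed

text \<open>As l k behaves like L/k^2, it is compared with L (1/k - 1/(k+1)), whose tail telescopes
  to exactly L/a.\<close>

lemma tail_sum_asymptotic:
  fixes l :: "nat \<Rightarrow> complex"
  assumes L: "(\<lambda>k. of_nat k ^ 2 * l k) \<longlonglongrightarrow> L"
  shows "summable l" "(\<lambda>a. of_nat a * (\<Sum>k. l (k + a))) \<longlonglongrightarrow> L"
proof -
  define d where "d k = 1 / real k - 1 / real (Suc k)" for k
  have d_sums: "(\<lambda>k. d (k + a)) sums (1 / real a)" for a
    using telescope_sums'[OF LIMSEQ_ignore_initial_segment[OF lim_1_over_n, of a]]
    by (simp add: d_def)
  have err: "\<forall>\<^sub>F a in sequentially. summable (\<lambda>k. l (k + a)) \<and>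
      norm (of_nat a * (\<Sum>k. l (k + a)) - L) \<le> e" if e: "e > 0" for e
  proof -
    \<comment> \<open>The factor 1 + 1/k equals 1/k^2 divided by \<open>d k\<close>, so this says
      that the quotient of \<open>l k\<close> and \<open>d k\<close> tends to L.\<close>
    have "(\<lambda>k. of_nat k ^ 2 * l k * of_real (1 + 1 / real k) - L) \<longlonglongrightarrow> L * of_real (1 + 0) - L"
      by (intro tendsto_intros L lim_1_over_n)
    then have "\<forall>\<^sub>F k in sequentially. norm (of_nat k ^ 2 * l k * of_real (1 + 1 / real k) - L) < e"
      using e by (intro order_tendstoD(2)[OF tendsto_norm]) auto
    then obtain K where K: "\<And>k. k \<ge> K \<Longrightarrow> norm (of_nat k ^ 2 * l k * of_real (1 + 1 / real k) - L) < e"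
      unfolding eventually_sequentially by blast
    have small: "norm (l k - L * of_real (d k)) \<le> e * d k" if k: "k \<ge> K" "k \<ge> 1" for k
    proof -
      have "d k = 1 / (real k * (real k + 1))" "real k ^ 2 * (1 + 1 / real k) = real k * (real k + 1)"
        using k by (auto simp: d_def field_simps power2_eq_square)
      then have d: "d k > 0" "real k ^ 2 * (1 + 1 / real k) * d k = 1"
        using k by auto
      have "of_nat k ^ 2 * l k * of_real (1 + 1 / real k) * of_real (d k) =
          l k * of_real (real k ^ 2 * (1 + 1 / real k) * d k)"
        by (simp del: of_real_add)
      then have "l k - L * of_real (d k) =
          (of_nat k ^ 2 * l k * of_real (1 + 1 / real k) - L) * of_real (d k)"
        unfolding d(2) by (simp add: left_diff_distrib)
      then have "norm (l k - L * of_real (d k)) =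
          norm (of_nat k ^ 2 * l k * of_real (1 + 1 / real k) - L) * d k"
        using d(1) by (simp add: norm_mult)
      then show ?thesis using K[OF k(1)] d(1) by (simp add: mult_right_mono)
    qed
    show ?thesis
    proof (rule eventually_mono[OF eventually_ge_at_top[of "max K 1"]])
      fix a assume a: "max K 1 \<le> a"
      have sd: "(\<lambda>k. L * of_real (d (k + a))) sums (L * of_real (1 / real a))"
        by (intro sums_mult sums_of_real d_sums)
      have se: "summable (\<lambda>k. e * d (k + a))" "(\<Sum>k. e * d (k + a)) = e * (1 / real a)"
        using sums_mult[OF d_sums[of a], of e] by (auto simp: sums_iff)
      have le: "norm (l (k + a) - L * of_real (d (k + a))) \<le> e * d (k + a)" for k
        using a by (intro small) auto
      have sdiff: "summable (\<lambda>k. l (k + a) - L * of_real (d (k + a)))"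
        by (rule summable_comparison_test'[OF se(1)]) (use le in auto)
      from summable_add[OF this sums_summable[OF sd]] have sl: "summable (\<lambda>k. l (k + a))"
        by simp
      have "(\<Sum>k. l (k + a)) - L * of_real (1 / real a) = (\<Sum>k. l (k + a) - L * of_real (d (k + a)))"
        using suminf_diff[OF sl sums_summable[OF sd]] sums_unique[OF sd] by simp
      also have "norm \<dots> \<le> e * (1 / real a)"
        unfolding se(2)[symmetric] by (intro norm_suminf_le le se)
      finally have "norm ((\<Sum>k. l (k + a)) - L * of_real (1 / real a)) * real a \<le> e * (1 / real a) * real a"
        by (intro mult_right_mono) auto
      moreover have "norm ((\<Sum>k. l (k + a)) - L * of_real (1 / real a)) * real a =
          norm (((\<Sum>k. l (k + a)) - L * of_real (1 / real a)) * of_nat a)"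
        by (simp add: norm_mult)
      moreover have "((\<Sum>k. l (k + a)) - L * of_real (1 / real a)) * of_nat a =
          of_nat a * (\<Sum>k. l (k + a)) - L"
        using a by (simp add: field_simps)
      ultimately show "summable (\<lambda>k. l (k + a)) \<and> norm (of_nat a * (\<Sum>k. l (k + a)) - L) \<le> e"
        using a sl by simp
    qed
  qed
  from err[of 1] obtain a where "summable (\<lambda>k. l (k + a))"
    unfolding eventually_sequentially by force
  then show "summable l" by (simp add: summable_iff_shift)
  show "(\<lambda>a. of_nat a * (\<Sum>k. l (k + a))) \<longlonglongrightarrow> L"
  proof (rule tendstoI)
    fix e :: real assume "e > 0"
    then show "\<forall>\<^sub>F a in sequentially. dist (of_nat a * (\<Sum>k. l (k + a))) L < e"
      using err[of "e / 2"] by (auto elim!: eventually_mono simp: dist_norm)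
  qed
qed

section \<open>First-order asymptotics of Gamma(a + it) / Gamma(a)\<close>

text \<open>This is Gamma(a + it) / (Gamma(a) a^(it)). Removing the phase a^(it) makes the limit 1
  and the logarithmic increments summable; raised to the power M, it is the phase of frequency M log
  a.\<close>

definition Gamma_shift_ratio :: "real \<Rightarrow> nat \<Rightarrow> complex" where
  "Gamma_shift_ratio t a = Gamma (Complex (real a) t) / of_real (Gamma (real a)) *
     exp (- \<i> * of_real (t * ln (real a)))"

text \<open>The reciprocal of Euler's limit for Gamma(z). The base point z = 1 + it is never a pole,
  unlike it at t = 0; the resulting shift by one step is undone by the factor 1 + it/n.\<close>

lemma Gamma_shift_ratio_LIMSEQ: "Gamma_shift_ratio t \<longlonglongrightarrow> 1"
proof -
  define z where "z = Complex 1 t"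
  have z: "z \<notin> \<int>\<^sub>\<le>\<^sub>0" by (auto simp: z_def complex_eq_iff elim!: nonpos_Ints_cases)
  have "(\<lambda>n. Gamma_series' z n / Gamma z) \<longlonglongrightarrow> Gamma z / Gamma z"
    using Gamma_nonzero[OF z] by (intro tendsto_intros Gamma_series'_LIMSEQ)
  then have "(\<lambda>n. Gamma_series' z n / Gamma z) \<longlonglongrightarrow> 1"
    using Gamma_nonzero[OF z] by simp
  moreover have "(\<lambda>n. 1 + \<i> * of_real (t * (1 / real n))) \<longlonglongrightarrow> 1 + \<i> * of_real (t * 0)"
    by (intro tendsto_intros lim_1_over_n)
  ultimately have "(\<lambda>n. inverse (Gamma_series' z n / Gamma z * (1 + \<i> * of_real (t * (1 / real n))))) \<longlonglongrightarrow>
      inverse (1 * (1 + \<i> * of_real (t * 0)))"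
    by (intro tendsto_inverse tendsto_mult) auto
  moreover have "\<forall>\<^sub>F n in sequentially.
      inverse (Gamma_series' z n / Gamma z * (1 + \<i> * of_real (t * (1 / real n)))) = Gamma_shift_ratio t n"
  proof (rule eventually_mono[OF eventually_gt_at_top[of 0]])
    fix n :: nat assume n: "n > 0"
    have nz: "Complex (real n) t \<notin> \<int>\<^sub>\<le>\<^sub>0" "Complex (real n) t \<noteq> 0"
      using n by (auto simp: complex_eq_iff elim!: nonpos_Ints_cases)
    have shift: "z + of_nat n = Complex (real n) t + 1" by (simp add: z_def complex_eq_iff)
    have poch: "pochhammer z n = Complex (real n) t * Gamma (Complex (real n) t) / Gamma z"
      unfolding pochhammer_Gamma[OF z] shift Gamma_plus1[OF nz(1)] ..
    have "exp (z * of_real (ln (real n))) = exp (of_real (ln (real n)) + \<i> * of_real (t * ln (real n)))"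
      by (rule arg_cong[of _ _ exp]) (simp add: z_def complex_eq_iff)
    then have ez: "exp (z * of_real (ln (real n))) = of_nat n * exp (\<i> * of_real (t * ln (real n)))"
      using n by (simp add: exp_add exp_of_real)
    have G: "complex_of_real (Gamma (real n)) = fact (n - 1)"
      using Gamma_fact[of "n - 1", where 'a = real] n by (simp add: of_nat_diff)
    have fac: "of_nat n * (1 + \<i> * of_real (t * (1 / real n))) = Complex (real n) t"
      using n by (simp add: complex_eq_iff)
    have "Gamma_series' z n / Gamma z * (1 + \<i> * of_real (t * (1 / real n))) =
       fact (n - 1) * exp (\<i> * of_real (t * ln (real n))) *
       (of_nat n * (1 + \<i> * of_real (t * (1 / real n)))) /
       (Complex (real n) t * Gamma (Complex (real n) t))"
      unfolding Gamma_series'_def poch ez using Gamma_nonzero[OF z] ez by simp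
    also have "\<dots> = fact (n - 1) * exp (\<i> * of_real (t * ln (real n))) / Gamma (Complex (real n) t)"
      unfolding fac using nz(2) by simp
    finally show "inverse (Gamma_series' z n / Gamma z * (1 + \<i> * of_real (t * (1 / real n)))) =
        Gamma_shift_ratio t n"
      by (simp add: Gamma_shift_ratio_def G exp_minus field_simps)
  qed
  ultimately show ?thesis
    by (auto dest: Lim_transform_eventually)
qed

text \<open>A logarithm in terms of real functions, so that real and imaginary parts can be expanded
  separately and no branch has to be discussed.\<close>

lemma one_plus_ii_eq_exp:
  "1 + \<i> * of_real x = exp (Complex (ln (1 + x\<^sup>2) / 2) (arctan x))"
proof -
  have "exp (ln (1 + x\<^sup>2) / 2) = sqrt (1 + x\<^sup>2)"
    by (simp add: ln_sqrt[symmetric] add_pos_nonneg)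
  moreover have "sqrt (1 + x\<^sup>2) \<noteq> 0"
    by (simp add: add_nonneg_eq_0_iff)
  ultimately show ?thesis
    by (simp add: exp_eq_polar complex_eq_iff cos_arctan sin_arctan)
qed

text \<open>A logarithm of (1 + it/k) (1 + 1/k)^(-it), the quotient of the shift ratios at k + 1 and
  at k.\<close>

definition Gamma_shift_log :: "real \<Rightarrow> nat \<Rightarrow> complex" where
  "Gamma_shift_log t k = Complex (ln (1 + (t / real k)\<^sup>2) / 2) (arctan (t / real k) - t * ln (1 + 1 / real k))"

lemma Gamma_shift_ratio_Suc:
  assumes k: "k \<ge> 1"
  shows "Gamma_shift_ratio t (Suc k) = Gamma_shift_ratio t k * exp (Gamma_shift_log t k)"
proof -
  have nz: "Complex (real k) t \<notin> \<int>\<^sub>\<le>\<^sub>0"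
    using k by (auto simp: complex_eq_iff elim!: nonpos_Ints_cases)
  have G1: "Gamma (Complex (real (Suc k)) t) = Complex (real k) t * Gamma (Complex (real k) t)"
    using Gamma_plus1[OF nz] by (simp add: complex_eq_iff plus_complex.code one_complex.code add.commute)
  have G2: "Gamma (real (Suc k)) = real k * Gamma (real k)"
    using Gamma_plus1[of "real k"] nonpos_Ints_nonpos[of "real k"] k by (auto simp: add.commute)
  have "1 + 1 / real k = real (Suc k) / real k" using k by (simp add: field_simps)
  then have ln_Suc: "ln (1 + 1 / real k) = ln (real (Suc k)) - ln (real k)"
    using k by (simp only: ln_div) simp
  have "exp (Gamma_shift_log t k) =
      exp (Complex (ln (1 + (t / real k)\<^sup>2) / 2) (arctan (t / real k)) +
        (- \<i> * of_real (t * ln (real (Suc k))) - (- \<i> * of_real (t * ln (real k)))))"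
    by (intro arg_cong[of _ _ exp]) (simp add: Gamma_shift_log_def ln_Suc complex_eq_iff right_diff_distrib)
  also have "\<dots> = (1 + \<i> * of_real (t / real k)) *
      (exp (- \<i> * of_real (t * ln (real (Suc k)))) / exp (- \<i> * of_real (t * ln (real k))))"
    by (simp only: exp_add exp_diff one_plus_ii_eq_exp)
  also have "1 + \<i> * of_real (t / real k) = Complex (real k) t / of_nat k"
    using k by (simp add: complex_eq_iff field_simps)
  finally show ?thesis
    unfolding Gamma_shift_ratio_def G1 G2 by (simp add: field_simps)
qed

text \<open>The 1/k parts of arctan(t/k) and t ln(1 + 1/k) cancel, thanks to the removed phase. The
  t/2 is the second-order term of ln(1 + 1/k), the t^2/2 comes from the modulus of 1 + it/k.\<close>

lemma Gamma_shift_log_asymptotic: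
  "(\<lambda>k. of_nat k ^ 2 * Gamma_shift_log t k) \<longlonglongrightarrow> Complex (t\<^sup>2 / 2) (t / 2)"
proof -
  have "(\<lambda>k. real k ^ 2 * (ln (1 + (t / real k)\<^sup>2) / 2)) \<longlonglongrightarrow> t\<^sup>2 / 2"
    by (cases "t = 0") (simp, real_asymp)
  moreover have "(\<lambda>k. real k ^ 2 * (arctan (t / real k) - t * ln (1 + 1 / real k))) \<longlonglongrightarrow> t / 2"
  proof -
    consider "t < 0" | "t = 0" | "t > 0" by linarith
    then show ?thesis by cases (real_asymp, simp, real_asymp)
  qed
  ultimately have "(\<lambda>k. Complex (real k ^ 2 * (ln (1 + (t / real k)\<^sup>2) / 2))
      (real k ^ 2 * (arctan (t / real k) - t * ln (1 + 1 / real k)))) \<longlonglongrightarrow> Complex (t\<^sup>2 / 2) (t / 2)"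
    by (rule tendsto_Complex)
  also have "(\<lambda>k. Complex (real k ^ 2 * (ln (1 + (t / real k)\<^sup>2) / 2))
      (real k ^ 2 * (arctan (t / real k) - t * ln (1 + 1 / real k)))) =
      (\<lambda>k. of_nat k ^ 2 * Gamma_shift_log t k)"
    by (rule ext, subst of_real_of_nat_eq[symmetric], subst of_real_power[symmetric])
       (simp add: Gamma_shift_log_def complex_eq_iff)
  finally show ?thesis .
qed

text \<open>The increments are summed from a up to infinity, where the ratio is 1.\<close>

lemma Gamma_shift_ratio_eq_exp:
  assumes a: "a \<ge> 1"
  shows "Gamma_shift_ratio t a = exp (- (\<Sum>k. Gamma_shift_log t (k + a)))"
proof -
  let ?l = "Gamma_shift_log t"
  have "summable (\<lambda>k. ?l (k + a))"
    using tail_sum_asymptotic(1)[OF Gamma_shift_log_asymptotic] by (simp add: summable_iff_shift)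
  then have lim: "(\<lambda>m. exp (\<Sum>k<m. ?l (k + a))) \<longlonglongrightarrow> exp (\<Sum>k. ?l (k + a))"
    by (intro tendsto_exp summable_LIMSEQ)
  have step: "Gamma_shift_ratio t (m + a) = Gamma_shift_ratio t a * exp (\<Sum>k<m. ?l (k + a))" for m
    using a by (induction m) (auto simp: Gamma_shift_ratio_Suc exp_add)
  have "(\<lambda>m. Gamma_shift_ratio t (m + a)) \<longlonglongrightarrow> Gamma_shift_ratio t a * exp (\<Sum>k. ?l (k + a))"
    unfolding step by (intro tendsto_intros lim)
  moreover have "(\<lambda>m. Gamma_shift_ratio t (m + a)) \<longlonglongrightarrow> 1"
    by (rule LIMSEQ_ignore_initial_segment[OF Gamma_shift_ratio_LIMSEQ])
  ultimately have "Gamma_shift_ratio t a * exp (\<Sum>k. ?l (k + a)) = 1"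
    by (rule LIMSEQ_unique)
  then show ?thesis by (simp add: exp_minus field_simps)
qed

text \<open>The exponent is minus M/a times a times the tail sum, and both M/a and a times the tail
  sum converge.\<close>

lemma Gamma_shift_ratio_power_tendsto:
  fixes a M :: "nat \<Rightarrow> nat"
  assumes a: "filterlim a at_top sequentially"
    and lim: "(\<lambda>k. real (M k) / real (a k)) \<longlonglongrightarrow> \<beta>"
  shows "(\<lambda>k. Gamma_shift_ratio t (a k) ^ M k) \<longlonglongrightarrow> exp (- of_real \<beta> * Complex (t\<^sup>2 / 2) (t / 2))"
proof -
  let ?S = "\<lambda>a. \<Sum>k. Gamma_shift_log t (k + a)"
  have "(\<lambda>k. of_nat (a k) * ?S (a k)) \<longlonglongrightarrow> Complex (t\<^sup>2 / 2) (t / 2)"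
    by (rule filterlim_compose[OF tail_sum_asymptotic(2)[OF Gamma_shift_log_asymptotic] a])
  then have "(\<lambda>k. exp (- of_real (real (M k) / real (a k)) * (of_nat (a k) * ?S (a k)))) \<longlonglongrightarrow>
      exp (- of_real \<beta> * Complex (t\<^sup>2 / 2) (t / 2))"
    by (intro tendsto_intros lim)
  moreover have "\<forall>\<^sub>F k in sequentially. exp (- of_real (real (M k) / real (a k)) * (of_nat (a k) * ?S (a k))) =
      Gamma_shift_ratio t (a k) ^ M k"
    using filterlim_at_top[THEN iffD1, OF a, rule_format, of 1]
    by eventually_elim (auto simp: Gamma_shift_ratio_eq_exp exp_of_nat_mult[symmetric])
  ultimately show ?thesis by (rule Lim_transform_eventually)
qed

section \<open>Limit of the weight\<close>

text \<open>Scaling t by sqrt \<beta> turns this into the characteristic function of the standard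
  normal distribution at -y / sqrt \<beta>.\<close>

lemma gaussian_fourier_integral:
  assumes \<beta>: "\<beta> > 0"
  shows "(\<integral>t. exp (- of_real (\<beta> * t\<^sup>2 / 2) - \<i> * of_real (t * y)) \<partial>lborel) =
         complex_of_real (sqrt (2 * pi / \<beta>) * exp (- y\<^sup>2 / (2 * \<beta>)))"
proof -
  define f where "f t = exp (- of_real (\<beta> * t\<^sup>2 / 2) - \<i> * complex_of_real (t * y))" for t
  define u where "u = - y / sqrt \<beta>"
  have scaled: "f (0 + 1 / sqrt \<beta> * x) = of_real (sqrt (2 * pi)) * (std_normal_density x *\<^sub>R iexp (u * x))" for x
  proof -
    have "f (0 + 1 / sqrt \<beta> * x) = exp (of_real (- x\<^sup>2 / 2) + \<i> * of_real (u * x))"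
      unfolding f_def using \<beta>
      by (intro arg_cong[of _ _ exp]) (simp add: complex_eq_iff u_def power_mult_distrib power_divide)
    also have "\<dots> = of_real (exp (- x\<^sup>2 / 2)) * iexp (u * x)"
      by (simp only: exp_add exp_of_real)
    also have "exp (- x\<^sup>2 / 2) = sqrt (2 * pi) * std_normal_density x"
      by (simp add: std_normal_density_def)
    finally show ?thesis by (simp add: scaleR_conv_of_real)
  qed
  have "(\<integral>x. std_normal_density x *\<^sub>R iexp (u * x) \<partial>lborel) = char std_normal_distribution u"
    unfolding char_def by (subst integral_density) (auto simp: normal_density_nonneg)
  also have "\<dots> = of_real (exp (- u\<^sup>2 / 2))"
    by (simp add: char_std_normal_distribution)
  finally have char: "(\<integral>x. std_normal_density x *\<^sub>R iexp (u * x) \<partial>lborel) = of_real (exp (- u\<^sup>2 / 2))" .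
  have "(\<integral>t. f t \<partial>lborel) = (1 / sqrt \<beta>) *\<^sub>R (\<integral>x. f (0 + 1 / sqrt \<beta> * x) \<partial>lborel)"
    using \<beta> by (subst lborel_integral_real_affine[of "1 / sqrt \<beta>" f 0]) auto
  also have "(\<integral>x. f (0 + 1 / sqrt \<beta> * x) \<partial>lborel) = of_real (sqrt (2 * pi)) * of_real (exp (- u\<^sup>2 / 2))"
    unfolding scaled char[symmetric] by (rule integral_mult_right_zero)
  also have "u\<^sup>2 = y\<^sup>2 / \<beta>" using \<beta> by (simp add: u_def power_divide)
  finally show ?thesis
    unfolding f_def by (simp add: scaleR_conv_of_real real_sqrt_divide field_simps)
qed

lemma integrable_Lorentzian:
  assumes \<delta>: "\<delta> > 0"
  shows "integrable lborel (\<lambda>t::real. 1 / (1 + \<delta> * t\<^sup>2))"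
proof (rule Bochner_Integration.integrable_bound[OF integrable_Cauchy_density[of "1 / min 1 \<delta>"]])
  have "norm (1 / (1 + \<delta> * t\<^sup>2)) \<le> norm (1 / min 1 \<delta> / (1 + t\<^sup>2))" for t :: real
  proof -
    have "min 1 \<delta> * (1 + t\<^sup>2) \<le> 1 + \<delta> * t\<^sup>2"
      unfolding distrib_left mult_1_right by (intro add_mono mult_right_mono) auto
    moreover have "min 1 \<delta> * (1 + t\<^sup>2) > 0" using \<delta> by (simp add: add_pos_nonneg)
    ultimately have "1 / (1 + \<delta> * t\<^sup>2) \<le> 1 / (min 1 \<delta> * (1 + t\<^sup>2))"
      by (intro divide_left_mono) auto
    then show ?thesis using \<delta> by (simp add: add_pos_nonneg)
  qed
  then show "AE t in lborel. norm (1 / (1 + \<delta> * t\<^sup>2)) \<le> norm (1 / min 1 \<delta> / (1 + t\<^sup>2))" by simp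
qed simp

lemma integral_dominated_convergence_eventually:
  fixes s :: "nat \<Rightarrow> 'a \<Rightarrow> 'b::{banach, second_countable_topology}"
  assumes "f \<in> borel_measurable L" "\<And>i. s i \<in> borel_measurable L" "integrable L w"
    and lim: "\<And>x. (\<lambda>i. s i x) \<longlonglongrightarrow> f x"
    and bound: "\<forall>\<^sub>F i in sequentially. \<forall>x. norm (s i x) \<le> w x"
  shows "(\<lambda>i. integral\<^sup>L L (s i)) \<longlonglongrightarrow> integral\<^sup>L L f"
proof -
  obtain K where K: "\<And>i x. i \<ge> K \<Longrightarrow> norm (s i x) \<le> w x"
    using bound unfolding eventually_sequentially by blast
  have "(\<lambda>i. integral\<^sup>L L (s (i + K))) \<longlonglongrightarrow> integral\<^sup>L L f"
    using assms by (intro integral_dominated_convergence[where w = w])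
      (auto intro!: K LIMSEQ_ignore_initial_segment)
  then show ?thesis by (rule LIMSEQ_offset)
qed

lemma borel_measurable_Gamma_vertical:
  assumes "x > 0"
  shows "(\<lambda>t. Gamma (Complex x t)) \<in> borel_measurable borel"
proof -
  have "Complex x = (\<lambda>t. of_real x + \<i> * of_real t)" by (auto simp: complex_eq_iff)
  moreover have "continuous_on UNIV (\<lambda>t. Gamma (of_real x + \<i> * of_real t))"
    using assms by (intro continuous_on_compose2[OF continuous_on_Gamma, of "{s. Re s > 0}"])
      (auto intro!: continuous_intros elim!: nonpos_Ints_cases)
  ultimately show ?thesis by (simp add: borel_measurable_continuous_onI)
qed

lemma Gamma_ratio_integral_tendsto:
  fixes a M :: "nat \<Rightarrow> nat"
  assumes a: "filterlim a at_top sequentially" and a1: "\<And>k. a k \<ge> 1" and \<beta>: "\<beta> > 0"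
    and lim: "(\<lambda>k. real (M k) / real (a k)) \<longlonglongrightarrow> \<beta>"
    and s: "(\<lambda>k. s k) \<longlonglongrightarrow> \<sigma>"
  shows "(\<lambda>k. \<integral>t. (Gamma (Complex (real (a k)) t) / of_real (Gamma (real (a k)))) ^ M k *
            exp (- \<i> * of_real (t * (real (M k) * ln (real (a k)) + s k))) \<partial>lborel)
         \<longlonglongrightarrow> complex_of_real (sqrt (2 * pi / \<beta>) * exp (- (\<sigma> + \<beta> / 2)\<^sup>2 / (2 * \<beta>)))"
proof -
  let ?F = "\<lambda>k t. (Gamma (Complex (real (a k)) t) / of_real (Gamma (real (a k)))) ^ M k *
            exp (- \<i> * of_real (t * (real (M k) * ln (real (a k)) + s k)))"
  have split: "?F k t = Gamma_shift_ratio t (a k) ^ M k * exp (- \<i> * of_real (t * s k))" for k t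
  proof -
    have "exp (- \<i> * of_real (t * (real (M k) * ln (real (a k)) + s k))) =
        exp (of_nat (M k) * (- \<i> * of_real (t * ln (real (a k)))) + (- \<i> * of_real (t * s k)))"
      by (rule arg_cong[of _ _ exp]) (simp add: complex_eq_iff algebra_simps)
    then show ?thesis
      by (simp only: Gamma_shift_ratio_def power_mult_distrib exp_add exp_of_nat_mult mult.assoc)
  qed
  have pointwise: "(\<lambda>k. ?F k t) \<longlonglongrightarrow> exp (- of_real (\<beta> * t\<^sup>2 / 2) - \<i> * of_real (t * (\<sigma> + \<beta> / 2)))" for t
  proof -
    have "(\<lambda>k. ?F k t) \<longlonglongrightarrow> exp (- of_real \<beta> * Complex (t\<^sup>2 / 2) (t / 2)) * exp (- \<i> * of_real (t * \<sigma>))"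
      unfolding split by (intro tendsto_intros Gamma_shift_ratio_power_tendsto a lim s)
    \<comment> \<open>The imaginary part t/2 contributes a linear phase, which moves the frequency
      from \<sigma> to \<sigma> + \<beta>/2.\<close>
    also have "exp (- of_real \<beta> * Complex (t\<^sup>2 / 2) (t / 2)) * exp (- \<i> * of_real (t * \<sigma>)) =
        exp (- of_real (\<beta> * t\<^sup>2 / 2) - \<i> * of_real (t * (\<sigma> + \<beta> / 2)))"
      unfolding exp_add[symmetric]
      by (rule arg_cong[of _ _ exp]) (simp add: complex_eq_iff algebra_simps)
    finally show ?thesis .
  qed
  \<comment> \<open>This half of \<beta> times the constant 1/9 of
    \<open>Gamma_ratio_power_le\<close> is the 1/18 in the dominating function.\<close>
  have "\<forall>\<^sub>F k in sequentially. real (M k) / real (a k) > \<beta> / 2"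
    using lim \<beta> by (intro order_tendstoD(1)) auto
  then have bound: "\<forall>\<^sub>F k in sequentially. \<forall>t. norm (?F k t) \<le> 1 / (1 + \<beta> / 18 * t\<^sup>2)"
  proof eventually_elim
    case (elim k)
    show ?case
    proof
      fix t
      have "\<beta> / 2 / 9 * t\<^sup>2 \<le> real (M k) / real (a k) / 9 * t\<^sup>2"
        by (intro mult_right_mono divide_right_mono less_imp_le[OF elim]) auto
      moreover have "real (M k) / real (a k) / 9 * t\<^sup>2 = real (M k) * t\<^sup>2 / (9 * real (a k))"
        by simp
      ultimately have "1 / (1 + real (M k) * t\<^sup>2 / (9 * real (a k))) \<le> 1 / (1 + \<beta> / 18 * t\<^sup>2)"
        using \<beta> by (intro divide_left_mono mult_pos_pos add_pos_nonneg add_left_mono) auto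
      moreover have "norm (?F k t) = norm (Gamma (Complex (real (a k)) t) / of_real (Gamma (real (a k)))) ^ M k"
        unfolding norm_mult norm_power by simp
      ultimately show "norm (?F k t) \<le> 1 / (1 + \<beta> / 18 * t\<^sup>2)"
        using Gamma_ratio_power_le[OF a1[of k], of t "M k"] by (simp only: order_trans)
    qed
  qed
  have "(\<lambda>k. integral\<^sup>L lborel (?F k)) \<longlonglongrightarrow>
      (\<integral>t. exp (- of_real (\<beta> * t\<^sup>2 / 2) - \<i> * of_real (t * (\<sigma> + \<beta> / 2))) \<partial>lborel)"
  proof (rule integral_dominated_convergence_eventually[OF _ _ integrable_Lorentzian pointwise bound])
    fix k
    have "real (a k) > 0" using a1[of k] by simp
    then show "?F k \<in> borel_measurable lborel"
      using borel_measurable_Gamma_vertical[of "real (a k)"] by measurable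
  qed (use \<beta> in auto)
  then show ?thesis
    unfolding gaussian_fourier_integral[OF \<beta>] .
qed

lemma ginibre_weight_tendsto:
  fixes a M :: "nat \<Rightarrow> nat" and z :: "nat \<Rightarrow> complex"
  assumes a: "filterlim a at_top sequentially" and a1: "\<And>k. a k \<ge> 1" and M: "\<And>k. M k \<ge> 1"
    and c: "c > 0" and \<beta>: "\<beta> > 0"
    and lim: "(\<lambda>k. real (M k) / real (a k)) \<longlonglongrightarrow> \<beta>"
    and z: "\<forall>\<^sub>F k in sequentially. z k \<noteq> 0"
    and s: "(\<lambda>k. 2 * ln (cmod (z k)) - real (M k) * ln (real (a k))) \<longlonglongrightarrow> \<sigma>"
  shows "(\<lambda>k. ginibre_weight c (M k) (z k) *
             of_real (cmod (z k) ^ (2 * a k) / Gamma (real (a k)) ^ M k))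
         \<longlonglongrightarrow> complex_of_real (exp (- (\<sigma> + \<beta> / 2)\<^sup>2 / (2 * \<beta>)) / sqrt (2 * pi * \<beta>))"
proof -
  have "(\<lambda>k. (\<integral>t. (Gamma (Complex (real (a k)) t) / of_real (Gamma (real (a k)))) ^ M k *
            exp (- \<i> * of_real (t * (real (M k) * ln (real (a k)) +
              (2 * ln (cmod (z k)) - real (M k) * ln (real (a k)))))) \<partial>lborel) / of_real (2 * pi))
      \<longlonglongrightarrow> complex_of_real (sqrt (2 * pi / \<beta>) * exp (- (\<sigma> + \<beta> / 2)\<^sup>2 / (2 * \<beta>))) / of_real (2 * pi)"
    by (intro tendsto_divide tendsto_const Gamma_ratio_integral_tendsto a a1 \<beta> lim s) auto
  moreover have "\<forall>\<^sub>F k in sequentially.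
      (\<integral>t. (Gamma (Complex (real (a k)) t) / of_real (Gamma (real (a k)))) ^ M k *
            exp (- \<i> * of_real (t * (real (M k) * ln (real (a k)) +
              (2 * ln (cmod (z k)) - real (M k) * ln (real (a k)))))) \<partial>lborel) / of_real (2 * pi) =
      ginibre_weight c (M k) (z k) * of_real (cmod (z k) ^ (2 * a k) / Gamma (real (a k)) ^ M k)"
    using z
  proof eventually_elim
    case (elim k)
    show ?case
      unfolding ginibre_weight_scaled[OF c a1 M elim] by simp
  qed
  moreover have "complex_of_real (sqrt (2 * pi / \<beta>) * exp (- (\<sigma> + \<beta> / 2)\<^sup>2 / (2 * \<beta>))) / of_real (2 * pi) =
      of_real (exp (- (\<sigma> + \<beta> / 2)\<^sup>2 / (2 * \<beta>)) / sqrt (2 * pi * \<beta>))"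
  proof -
    have "sqrt (2 * pi / \<beta>) / (2 * pi) = 1 / sqrt (2 * pi * \<beta>)"
      using \<beta> by (simp add: real_sqrt_divide real_sqrt_mult field_simps)
    then have "sqrt (2 * pi / \<beta>) * exp (- (\<sigma> + \<beta> / 2)\<^sup>2 / (2 * \<beta>)) / (2 * pi) =
        exp (- (\<sigma> + \<beta> / 2)\<^sup>2 / (2 * \<beta>)) / sqrt (2 * pi * \<beta>)"
      by (simp add: field_simps)
    then show ?thesis by (simp only: of_real_divide[symmetric])
  qed
  ultimately show ?thesis
    by (simp only:) (rule Lim_transform_eventually)
qed

section \<open>Limit of the sum\<close>

lemma suminf_tendsto_dominated:
  fixes f :: "nat \<Rightarrow> nat \<Rightarrow> complex"
  assumes lim: "\<And>m. (\<lambda>k. f k m) \<longlonglongrightarrow> g m"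
    and bound: "\<forall>\<^sub>F k in sequentially. \<forall>m. norm (f k m) \<le> B m" and B: "summable B"
  shows "(\<lambda>k. \<Sum>m. f k m) \<longlonglongrightarrow> (\<Sum>m. g m)" "summable (\<lambda>m. norm (g m))"
proof -
  have "\<forall>\<^sub>F (m, k) in at_top \<times>\<^sub>F sequentially. norm (f k m) \<le> B m"
    unfolding eventually_prod_filter using bound
    by (intro exI[of _ "\<lambda>_. True"] exI[of _ "\<lambda>k. \<forall>m. norm (f k m) \<le> B m"]) auto
  from tannerys_theorem[OF lim this B]
  show "(\<lambda>k. \<Sum>m. f k m) \<longlonglongrightarrow> (\<Sum>m. g m)" "summable (\<lambda>m. norm (g m))"
    by auto
qed

lemma summable_gaussian:
  assumes \<delta>: "\<delta> > 0"
  shows "summable (\<lambda>m. exp (R * real m - \<delta> * (real m)\<^sup>2))"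
proof (rule summable_comparison_test_ev)
  have "\<forall>\<^sub>F m in sequentially. real m \<ge> (R + 1) / \<delta>"
    using filterlim_real_sequentially by (simp add: filterlim_at_top)
  then show "\<forall>\<^sub>F m in sequentially. norm (exp (R * real m - \<delta> * (real m)\<^sup>2)) \<le> exp (-1) ^ m"
  proof eventually_elim
    case (elim m)
    then have "R + 1 \<le> \<delta> * real m" using \<delta> by (simp add: field_simps)
    then have "(R + 1) * real m \<le> \<delta> * real m * real m" by (rule mult_right_mono) simp
    then have "R * real m - \<delta> * (real m)\<^sup>2 \<le> real m * (-1)"
      by (simp add: algebra_simps power2_eq_square)
    then show ?case by (simp flip: exp_of_nat_mult)
  qed
  show "summable (\<lambda>m. exp (- 1 :: real) ^ m)" by (rule summable_geometric) simp
qed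

lemma one_plus_div_power_tendsto:
  fixes a M :: "nat \<Rightarrow> nat"
  assumes a: "filterlim a at_top sequentially"
    and lim: "(\<lambda>k. real (M k) / real (a k)) \<longlonglongrightarrow> \<beta>"
  shows "(\<lambda>k. (1 + x / real (a k)) ^ M k) \<longlonglongrightarrow> exp (\<beta> * x)"
proof -
  have "(\<lambda>n::nat. real n * ln (1 + x / real n)) \<longlonglongrightarrow> x" by real_asymp
  then have "(\<lambda>k. real (a k) * ln (1 + x / real (a k))) \<longlonglongrightarrow> x"
    by (rule filterlim_compose[OF _ a])
  then have "(\<lambda>k. exp (real (M k) / real (a k) * (real (a k) * ln (1 + x / real (a k))))) \<longlonglongrightarrow> exp (\<beta> * x)"
    by (intro tendsto_intros lim)
  moreover have "\<forall>\<^sub>F n::nat in sequentially. n > 0 \<and> 1 + x / real n > 0"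
    by (intro eventually_conj eventually_gt_at_top) real_asymp
  then have "\<forall>\<^sub>F k in sequentially. a k > 0 \<and> 1 + x / real (a k) > 0"
    using a by (rule eventually_compose_filterlim)
  then have "\<forall>\<^sub>F k in sequentially. exp (real (M k) / real (a k) * (real (a k) * ln (1 + x / real (a k)))) =
      (1 + x / real (a k)) ^ M k"
    by eventually_elim (auto simp: exp_of_nat_mult)
  ultimately show ?thesis by (rule Lim_transform_eventually)
qed

section \<open>Gamma ratios at integer distance from a, as finite products\<close>

text \<open>For m < a this is Gamma(a) / (Gamma(a - m) a^m). For a >= 1 it vanishes from m = a on,
  so a series weighted by a positive power of it stops by itself.\<close>

definition down_prod :: "nat \<Rightarrow> nat \<Rightarrow> real" where
  "down_prod a m = (\<Prod>l<m. 1 + - real (Suc l) / real a)"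

text \<open>For a >= 1 this is Gamma(a) a^m / Gamma(a + m). The factor with l = 0 is 1, so the first
  step upwards costs nothing; hence i(i+1)/2, not (i+1)(i+2)/2, in the bounds at
  \<open>Suc i\<close>.\<close>

definition up_prod :: "nat \<Rightarrow> nat \<Rightarrow> real" where
  "up_prod a m = (\<Prod>l<m. 1 / (1 + real l / real a))"

lemma up_prod_nonneg: "up_prod a m \<ge> 0"
  unfolding up_prod_def by (intro prod_nonneg) auto

lemma Gamma_down_prod:
  assumes "m < a"
  shows "Gamma (real a) = Gamma (real (a - m)) * real a ^ m * down_prod a m"
  using assms
proof (induction m)
  case (Suc m)
  have pos: "real (a - Suc m) \<notin> \<int>\<^sub>\<le>\<^sub>0" using nonpos_Ints_nonpos[of "real (a - Suc m)"] Suc by auto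
  have "real (a - m) = real (a - Suc m) + 1" using Suc by (simp add: of_nat_diff)
  then have G: "Gamma (real (a - m)) = real (a - Suc m) * Gamma (real (a - Suc m))"
    using Gamma_plus1[OF pos] by simp
  have "real (a - Suc m) = real a * (1 + - real (Suc m) / real a)"
    using Suc by (simp add: of_nat_diff field_simps)
  then have G': "Gamma (real (a - m)) = real a * (1 + - real (Suc m) / real a) * Gamma (real (a - Suc m))"
    using G by simp
  have "Gamma (real a) = Gamma (real (a - m)) * real a ^ m * down_prod a m"
    using Suc by simp
  then show ?case
    unfolding G' by (simp add: down_prod_def mult_ac)
qed (simp add: down_prod_def)

lemma Gamma_up_prod:
  assumes "a \<ge> 1"
  shows "Gamma (real (a + m)) * up_prod a m = Gamma (real a) * real a ^ m"
proof (induction m)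
  case (Suc m)
  have pos: "real (a + m) \<notin> \<int>\<^sub>\<le>\<^sub>0" using nonpos_Ints_nonpos[of "real (a + m)"] assms by auto
  have "real (a + Suc m) = real (a + m) + 1" by simp
  then have G: "Gamma (real (a + Suc m)) = real (a + m) * Gamma (real (a + m))"
    using Gamma_plus1[OF pos] by (simp only:)
  have "real (a + m) * (1 / (1 + real m / real a)) = real a"
    using assms by (simp add: field_simps)
  then have "Gamma (real (a + Suc m)) * up_prod a (Suc m) = real a * (Gamma (real (a + m)) * up_prod a m)"
    unfolding G up_prod_def prod.lessThan_Suc by (metis (no_types, lifting) mult.assoc mult.commute)
  then show ?case using Suc by simp
qed (simp add: up_prod_def)

lemma down_prod_eq_0: "1 \<le> a \<Longrightarrow> a \<le> m \<Longrightarrow> down_prod a m = 0"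
  unfolding down_prod_def by (rule prod_zero) (auto intro!: bexI[of _ "a - 1"] simp: of_nat_diff)

lemma sum_Suc_real: "(\<Sum>l<m. real (Suc l)) = real m * (real m + 1) / 2"
  by (induction m) (auto simp: field_simps)

text \<open>By 1 + x <= exp x in each factor the exponents add up to -m(m+1)/(2a), and the power M
  turns 1/a into M/a >= \<beta>.\<close>

lemma down_prod_power_le:
  assumes a: "a \<ge> 1" and M: "M \<ge> 1" and \<beta>: "\<beta> \<le> real M / real a" "\<beta> > 0"
  shows "norm (down_prod a m ^ M) \<le> exp (- \<beta> / 2 * (real m)\<^sup>2)"
proof (cases "m < a")
  case False
  then show ?thesis using a M by (simp add: down_prod_eq_0 power_0_left)
next
  case True
  have nonneg: "0 \<le> 1 + - real (Suc l) / real a" if "l < m" for l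
    using that True by (simp add: field_simps)
  have "1 + - real (Suc l) / real a \<le> exp (- real (Suc l) / real a)" for l
    by (rule exp_ge_add_one_self)
  then have "down_prod a m \<le> (\<Prod>l<m. exp (- real (Suc l) / real a))"
    unfolding down_prod_def using nonneg by (intro prod_mono conjI) auto
  also have "\<dots> = exp (- (real m * (real m + 1) / 2) / real a)"
    by (simp add: exp_sum[symmetric] sum_divide_distrib[symmetric] sum_negf sum_Suc_real del: of_nat_Suc)
  finally have "down_prod a m ^ M \<le> exp (- (real m * (real m + 1) / 2) / real a) ^ M"
    using nonneg by (intro power_mono) (auto simp: down_prod_def intro!: prod_nonneg)
  also have "\<dots> = exp (- (real M / real a) * (real m * (real m + 1) / 2))"
    by (simp flip: exp_of_nat_mult)
  also have "\<dots> \<le> exp (- \<beta> / 2 * (real m)\<^sup>2)"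
  proof -
    have "\<beta> * (real m * real m / 2) \<le> real M / real a * (real m * (real m + 1) / 2)"
      using \<beta> by (intro mult_mono divide_right_mono) auto
    then show ?thesis by (simp add: power2_eq_square)
  qed
  finally have "down_prod a m ^ M \<le> exp (- \<beta> / 2 * (real m)\<^sup>2)" .
  moreover have "down_prod a m \<ge> 0" using nonneg by (auto simp: down_prod_def intro!: prod_nonneg)
  ultimately show ?thesis by simp
qed

text \<open>Here exp(-l/a) is a lower bound for 1/(1 + l/a), not an upper one. Writing the factor as
  1 - l/(a + l) gives the upper bound exp(-l/(a + l)), and the range a + l <= N <= B a makes the
  denominator comparable to a, at the cost of B in the exponent.\<close>

lemma up_prod_Suc_power_le:
  assumes a: "a \<ge> 1" and \<beta>: "\<beta> \<le> real M / real a" "\<beta> > 0"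
    and B: "B > 0" "real N \<le> B * real a" and i: "a + i \<le> N"
  shows "up_prod a (Suc i) ^ M \<le> exp (- (\<beta> / (2 * B)) * (real i)\<^sup>2)"
proof -
  have fac: "1 / (1 + real l / real a) \<le> exp (- (real l / (real a * B)))" if l: "l < Suc i" for l
  proof -
    have "real a + real l \<le> B * real a" using l i B(2) by linarith
    then have "real l / (real a * B) \<le> real l / (real a + real l)"
      using a B by (intro divide_left_mono) (auto simp: mult.commute)
    moreover have "1 / (1 + real l / real a) = 1 + - (real l / (real a + real l))"
      using a by (simp add: field_simps)
    moreover have "\<dots> \<le> exp (- (real l / (real a + real l)))" by (rule exp_ge_add_one_self)
    ultimately show ?thesis by (smt (verit) exp_le_cancel_iff)
  qed
  have "up_prod a (Suc i) \<le> (\<Prod>l<Suc i. exp (- (real l / (real a * B))))"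
    unfolding up_prod_def using fac by (intro prod_mono conjI) auto
  also have "\<dots> = exp (- (\<Sum>l<Suc i. real l) / (real a * B))"
    by (simp add: exp_sum[symmetric] sum_divide_distrib[symmetric] sum_negf del: sum.lessThan_Suc prod.lessThan_Suc)
  also have "(\<Sum>l<Suc i. real l) = real i * (real i + 1) / 2"
    by (induction i) (auto simp: field_simps)
  finally have "up_prod a (Suc i) ^ M \<le> exp (- (real i * (real i + 1) / 2) / (real a * B)) ^ M"
    by (intro power_mono up_prod_nonneg)
  also have "\<dots> = exp (- (real M / real a) * (real i * (real i + 1) / 2 / B))"
    by (simp flip: exp_of_nat_mult)
  also have "\<dots> \<le> exp (- (\<beta> / (2 * B)) * (real i)\<^sup>2)"
  proof -
    have "\<beta> * (real i * real i / 2 / B) \<le> real M / real a * (real i * (real i + 1) / 2 / B)"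
      using \<beta> B by (intro mult_mono divide_right_mono) auto
    then show ?thesis by (simp add: power2_eq_square)
  qed
  finally show ?thesis .
qed

lemma down_prod_power_tendsto:
  assumes "filterlim a at_top sequentially" "(\<lambda>k. real (M k) / real (a k)) \<longlonglongrightarrow> \<beta>"
  shows "(\<lambda>k. down_prod (a k) m ^ M k) \<longlonglongrightarrow> exp (- \<beta> * (real m * (real m + 1) / 2))"
proof -
  have "(\<lambda>k. \<Prod>l<m. (1 + - real (Suc l) / real (a k)) ^ M k) \<longlonglongrightarrow> (\<Prod>l<m. exp (\<beta> * - real (Suc l)))"
    by (intro tendsto_prod one_plus_div_power_tendsto assms)
  also have "(\<Prod>l<m. exp (\<beta> * - real (Suc l))) = exp (- \<beta> * (real m * (real m + 1) / 2))"
    unfolding exp_sum[OF finite_lessThan, symmetric] sum_distrib_left[symmetric] sum_negf sum_Suc_real by simp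
  finally show ?thesis by (simp only: down_prod_def prod_power_distrib)
qed

lemma up_prod_Suc_power_tendsto:
  assumes "filterlim a at_top sequentially" "(\<lambda>k. real (M k) / real (a k)) \<longlonglongrightarrow> \<beta>"
  shows "(\<lambda>k. up_prod (a k) (Suc i) ^ M k) \<longlonglongrightarrow> exp (- \<beta> * (real i * (real i + 1) / 2))"
proof -
  have "(\<lambda>k. \<Prod>l<Suc i. 1 / (1 + real l / real (a k)) ^ M k) \<longlonglongrightarrow> (\<Prod>l<Suc i. 1 / exp (\<beta> * real l))"
    by (intro tendsto_prod tendsto_divide tendsto_const one_plus_div_power_tendsto assms) auto
  also have "(\<Prod>l<Suc i. 1 / exp (\<beta> * real l)) = exp (- (\<beta> * (\<Sum>l<Suc i. real l)))"
  proof -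
    have "(\<Prod>l<Suc i. 1 / exp (\<beta> * real l)) = (\<Prod>l<Suc i. exp (- (\<beta> * real l)))"
      by (intro prod.cong) (auto simp: exp_minus divide_inverse)
    then show ?thesis
      by (simp only: exp_sum[OF finite_lessThan, symmetric] sum_negf sum_distrib_left[symmetric])
  qed
  also have "(\<Sum>l<Suc i. real l) = real i * (real i + 1) / 2"
    by (induction i) (auto simp: field_simps)
  finally show ?thesis by (simp add: up_prod_def prod_power_distrib power_divide del: prod.lessThan_Suc)
qed

text \<open>The reference term j = a - 1 has denominator Gamma(a)^M, the normalization already used
  for the weight. Both halves are extended to infinite series so that dominated convergence for
  series applies to each; only the upper one needs an explicit cutoff.\<close>

lemma ginibre_sum_split:
  fixes \<zeta> :: complex
  assumes a: "1 \<le> a" "a \<le> N" and M: "M \<ge> 1" and y: "y = of_nat a ^ M * exp \<zeta>"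
  shows "(\<Sum>j<N. y ^ j / Gamma (of_nat j + 1) ^ M) = y ^ (a - 1) / of_real (Gamma (real a)) ^ M *
     ((\<Sum>m. exp (- of_nat m * \<zeta>) * of_real (down_prod a m ^ M)) +
      (\<Sum>i. if i < N - a then exp (of_nat (Suc i) * \<zeta>) * of_real (up_prod a (Suc i) ^ M) else 0))"
proof -
  define T where "T j = y ^ j / Gamma (of_nat j + 1) ^ M" for j
  have T: "T j = y ^ j / of_real (Gamma (real (Suc j))) ^ M" for j
    unfolding T_def by (simp add: Gamma_complex_of_real[symmetric] add.commute)
  have pos: "Gamma (real j) \<noteq> 0" if "j \<ge> 1" for j
    using less_imp_neq[OF Gamma_real_pos[of "real j"], symmetric] that by linarith
  have ym: "y ^ m = (of_nat a ^ m) ^ M * exp (of_nat m * \<zeta>)" for m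
    unfolding y power_mult_distrib exp_of_nat_mult by (simp only: power_mult[symmetric] mult.commute)
  have down: "T (a - 1 - m) = y ^ (a - 1) / of_real (Gamma (real a)) ^ M *
      (exp (- of_nat m * \<zeta>) * of_real (down_prod a m ^ M))" if m: "m < a" for m
  proof -
    have G: "Gamma (real a) = Gamma (real (a - m)) * (real a ^ m * down_prod a m)"
      using Gamma_down_prod[OF m] by simp
    then have nz: "Gamma (real (a - m)) \<noteq> 0" "real a ^ m * down_prod a m \<noteq> 0"
      using pos[of a] a by auto
    have "y ^ (a - 1) = y ^ (a - 1 - m) * y ^ m"
      using m by (simp flip: power_add)
    then have "y ^ (a - 1) = y ^ (a - 1 - m) * (of_nat a ^ m) ^ M * exp (of_nat m * \<zeta>)"
      by (simp add: ym)
    moreover have "Suc (a - 1 - m) = a - m" using m by simp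
    ultimately show ?thesis
      using nz a unfolding T G by (simp add: power_mult_distrib exp_minus field_simps)
  qed
  have up: "T (a + i) = y ^ (a - 1) / of_real (Gamma (real a)) ^ M *
      (exp (of_nat (Suc i) * \<zeta>) * of_real (up_prod a (Suc i) ^ M))" for i
  proof -
    have G: "Gamma (real a) * real a ^ Suc i = Gamma (real (a + Suc i)) * up_prod a (Suc i)"
      using Gamma_up_prod[of a "Suc i"] a by simp
    have nz: "Gamma (real a) \<noteq> 0" "Gamma (real (a + Suc i)) \<noteq> 0"
      using pos[OF a(1)] pos[of "a + Suc i"] by (blast, linarith)
    have "(complex_of_real (Gamma (real a)) * of_nat a ^ Suc i) ^ M =
        (of_real (Gamma (real (a + Suc i))) * of_real (up_prod a (Suc i))) ^ M"
      using arg_cong[OF G, of complex_of_real] by (simp del: power_Suc add_Suc_right of_nat_Suc)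
    then have G': "(complex_of_real (Gamma (real a))) ^ M * (of_nat a ^ Suc i) ^ M =
        of_real (Gamma (real (a + Suc i))) ^ M * of_real (up_prod a (Suc i)) ^ M"
      by (simp only: power_mult_distrib)
    have "a + i = (a - 1) + Suc i" using a by simp
    then have "y ^ (a + i) = y ^ (a - 1) * y ^ Suc i"
      by (simp only: power_add)
    then have y': "y ^ (a + i) = y ^ (a - 1) * ((of_nat a ^ Suc i) ^ M * exp (of_nat (Suc i) * \<zeta>))"
      by (simp only: ym)
    have "T (a + i) * of_real (Gamma (real a)) ^ M = y ^ (a - 1) * exp (of_nat (Suc i) * \<zeta>) *
       (of_real (Gamma (real a)) ^ M * (of_nat a ^ Suc i) ^ M) / of_real (Gamma (real (a + Suc i))) ^ M"
      unfolding T y' by (simp del: power_Suc of_nat_Suc)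
    also have "\<dots> = y ^ (a - 1) * exp (of_nat (Suc i) * \<zeta>) * of_real (up_prod a (Suc i)) ^ M"
      unfolding G' using nz by (simp del: power_Suc of_nat_Suc add_Suc_right)
    finally show ?thesis
      using nz by (simp add: field_simps del: power_Suc of_nat_Suc add_Suc_right)
  qed
  have "{..<N} = {..<a} \<union> {a..<N}" using a by auto
  then have "(\<Sum>j<N. T j) = (\<Sum>j<a. T j) + (\<Sum>j=a..<N. T j)"
    by (simp add: sum.union_disjoint ivl_disj_int)
  also have "(\<Sum>j<a. T j) = (\<Sum>m<a. T (a - 1 - m))"
    by (subst sum.nat_diff_reindex[symmetric]) simp
  also have "\<dots> = y ^ (a - 1) / of_real (Gamma (real a)) ^ M *
      (\<Sum>m<a. exp (- of_nat m * \<zeta>) * of_real (down_prod a m ^ M))"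
    unfolding sum_distrib_left by (intro sum.cong refl down) auto
  also have "(\<Sum>m<a. exp (- of_nat m * \<zeta>) * of_real (down_prod a m ^ M)) =
      (\<Sum>m. exp (- of_nat m * \<zeta>) * of_real (down_prod a m ^ M))"
    using a M by (intro suminf_finite[symmetric]) (auto simp: down_prod_eq_0 power_0_left)
  also have "(\<Sum>j=a..<N. T j) = (\<Sum>i<N - a. T (a + i))"
    using sum.shift_bounds_nat_ivl[of T 0 a "N - a"] a by (simp add: add.commute lessThan_atLeast0)
  also have "\<dots> = y ^ (a - 1) / of_real (Gamma (real a)) ^ M *
      (\<Sum>i<N - a. exp (of_nat (Suc i) * \<zeta>) * of_real (up_prod a (Suc i) ^ M))"
    unfolding sum_distrib_left by (intro sum.cong refl up)
  also have "(\<Sum>i<N - a. exp (of_nat (Suc i) * \<zeta>) * of_real (up_prod a (Suc i) ^ M)) =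
      (\<Sum>i. if i < N - a then exp (of_nat (Suc i) * \<zeta>) * of_real (up_prod a (Suc i) ^ M) else 0)"
    by (subst suminf_finite[of "{..<N - a}"]) (auto intro!: sum.cong)
  finally show ?thesis by (simp add: T_def distrib_left)
qed

lemma norm_exp_mult_le:
  fixes \<zeta> :: complex
  assumes "norm \<zeta> \<le> R"
  shows "norm (exp (of_nat m * \<zeta>)) \<le> exp (R * real m)" "norm (exp (- of_nat m * \<zeta>)) \<le> exp (R * real m)"
proof -
  have "\<bar>Re \<zeta>\<bar> \<le> R" using abs_Re_le_cmod[of \<zeta>] assms by linarith
  then have "Re \<zeta> * real m \<le> R * real m" "- Re \<zeta> * real m \<le> R * real m"
    by (intro mult_right_mono; simp)+
  then show "norm (exp (of_nat m * \<zeta>)) \<le> exp (R * real m)" "norm (exp (- of_nat m * \<zeta>)) \<le> exp (R * real m)"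
    by (simp_all add: mult.commute)
qed

lemma down_sum_tendsto:
  fixes \<zeta> :: "nat \<Rightarrow> complex"
  assumes a: "filterlim a at_top sequentially" and a1: "\<And>k. a k \<ge> 1" and M: "\<And>k. M k \<ge> 1"
    and lim: "(\<lambda>k. real (M k) / real (a k)) \<longlonglongrightarrow> \<beta>" and \<beta>: "\<beta> > 0"
    and \<zeta>: "\<zeta> \<longlonglongrightarrow> w - of_real (\<beta> / 2)"
  shows "(\<lambda>k. \<Sum>m. exp (- of_nat m * \<zeta> k) * of_real (down_prod (a k) m ^ M k))
           \<longlonglongrightarrow> (\<Sum>m. exp (- (1 / 2) * of_real \<beta> * (of_nat m)\<^sup>2 - w * of_nat m))" (is ?A)
    and "summable (\<lambda>m. norm (exp (- (1 / 2) * of_real \<beta> * (of_nat m)\<^sup>2 - w * of_nat m)))" (is ?B)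
proof -
  define R where "R = norm (w - of_real (\<beta> / 2)) + 1"
  have "\<forall>\<^sub>F k in sequentially. norm (\<zeta> k) < R"
    by (rule order_tendstoD(2)[OF tendsto_norm[OF \<zeta>]]) (simp add: R_def)
  moreover have "\<forall>\<^sub>F k in sequentially. \<beta> / 2 < real (M k) / real (a k)"
    using \<beta> by (intro order_tendstoD(1)[OF lim]) simp
  ultimately have bound: "\<forall>\<^sub>F k in sequentially. \<forall>m.
      norm (exp (- of_nat m * \<zeta> k) * of_real (down_prod (a k) m ^ M k)) \<le> exp (R * real m - \<beta> / 4 * (real m)\<^sup>2)"
  proof eventually_elim
    case (elim k)
    show ?case
    proof
      fix m
      have "norm (exp (- of_nat m * \<zeta> k)) * norm (down_prod (a k) m ^ M k) \<le>
          exp (R * real m) * exp (- (\<beta> / 2) / 2 * (real m)\<^sup>2)"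
        using elim \<beta> by (intro mult_mono norm_exp_mult_le down_prod_power_le a1 M) auto
      also have "\<dots> = exp (R * real m - \<beta> / 4 * (real m)\<^sup>2)"
        unfolding exp_add[symmetric] by simp
      finally show "norm (exp (- of_nat m * \<zeta> k) * of_real (down_prod (a k) m ^ M k))
          \<le> exp (R * real m - \<beta> / 4 * (real m)\<^sup>2)"
        by (simp only: norm_mult norm_of_real real_norm_def)
    qed
  qed
  have term_lim: "(\<lambda>k. exp (- of_nat m * \<zeta> k) * of_real (down_prod (a k) m ^ M k))
      \<longlonglongrightarrow> exp (- (1 / 2) * of_real \<beta> * (of_nat m)\<^sup>2 - w * of_nat m)" for m
  proof -
    have "(\<lambda>k. exp (- of_nat m * \<zeta> k) * of_real (down_prod (a k) m ^ M k)) \<longlonglongrightarrow>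
       exp (- of_nat m * (w - of_real (\<beta> / 2))) * of_real (exp (- \<beta> * (real m * (real m + 1) / 2)))"
      by (intro tendsto_intros down_prod_power_tendsto a lim \<zeta>)
    \<comment> \<open>The shift by \<beta>/2 in the limit of \<zeta> removes the linear part of
      m(m+1)/2.\<close>
    also have "exp (- of_nat m * (w - of_real (\<beta> / 2))) * of_real (exp (- \<beta> * (real m * (real m + 1) / 2))) =
        exp (- (1 / 2) * of_real \<beta> * (of_nat m)\<^sup>2 - w * of_nat m)"
      unfolding exp_of_real[symmetric] exp_add[symmetric]
      by (rule arg_cong[of _ _ exp]) (simp add: field_simps power2_eq_square)
    finally show ?thesis .
  qed
  have "summable (\<lambda>m. exp (R * real m - \<beta> / 4 * (real m)\<^sup>2))"
    using \<beta> by (intro summable_gaussian) simp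
  from suminf_tendsto_dominated[OF term_lim bound this] show ?A ?B .
qed

lemma up_sum_tendsto:
  fixes \<zeta> :: "nat \<Rightarrow> complex"
  assumes a: "filterlim a at_top sequentially" and a1: "\<And>k. a k \<ge> 1"
    and lim: "(\<lambda>k. real (M k) / real (a k)) \<longlonglongrightarrow> \<beta>" and \<beta>: "\<beta> > 0"
    and \<zeta>: "\<zeta> \<longlonglongrightarrow> w - of_real (\<beta> / 2)"
    and N: "filterlim (\<lambda>k. N k - a k) at_top sequentially"
    and B: "B > 0" "\<forall>\<^sub>F k in sequentially. real (N k) \<le> B * real (a k)"
  shows "(\<lambda>k. \<Sum>i. if i < N k - a k then exp (of_nat (Suc i) * \<zeta> k) * of_real (up_prod (a k) (Suc i) ^ M k) else 0)
           \<longlonglongrightarrow> (\<Sum>i. exp (- (1 / 2) * of_real \<beta> * (of_nat (Suc i))\<^sup>2 + w * of_nat (Suc i)))" (is ?A)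
    and "summable (\<lambda>i. norm (exp (- (1 / 2) * of_real \<beta> * (of_nat (Suc i))\<^sup>2 + w * of_nat (Suc i))))" (is ?B)
proof -
  let ?T = "\<lambda>k i. exp (of_nat (Suc i) * \<zeta> k) * of_real (up_prod (a k) (Suc i) ^ M k)"
  define R where "R = norm (w - of_real (\<beta> / 2)) + 1"
  have "\<forall>\<^sub>F k in sequentially. norm (\<zeta> k) < R"
    by (rule order_tendstoD(2)[OF tendsto_norm[OF \<zeta>]]) (simp add: R_def)
  moreover have "\<forall>\<^sub>F k in sequentially. \<beta> / 2 < real (M k) / real (a k)"
    using \<beta> by (intro order_tendstoD(1)[OF lim]) simp
  ultimately have bound: "\<forall>\<^sub>F k in sequentially. \<forall>i.
      norm (if i < N k - a k then ?T k i else 0) \<le> exp R * exp (R * real i - \<beta> / (4 * B) * (real i)\<^sup>2)"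
    using B(2)
  proof eventually_elim
    case (elim k)
    show ?case
    proof
      fix i
      show "norm (if i < N k - a k then ?T k i else 0) \<le> exp R * exp (R * real i - \<beta> / (4 * B) * (real i)\<^sup>2)"
      proof (cases "i < N k - a k")
        case True
        have nonneg: "up_prod (a k) (Suc i) ^ M k \<ge> 0"
          by (intro zero_le_power up_prod_nonneg)
        have "norm (exp (of_nat (Suc i) * \<zeta> k)) * (up_prod (a k) (Suc i) ^ M k) \<le>
            exp (R * real (Suc i)) * exp (- (\<beta> / 2 / (2 * B)) * (real i)\<^sup>2)"
          using elim \<beta> True B(1) a1[of k] nonneg
          by (intro mult_mono norm_exp_mult_le up_prod_Suc_power_le[where N = "N k"]) auto
        also have "\<dots> = exp R * exp (R * real i - \<beta> / (4 * B) * (real i)\<^sup>2)"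
          unfolding exp_add[symmetric] by (simp add: algebra_simps)
        finally show ?thesis
          using True nonneg by (simp add: norm_mult del: of_nat_Suc of_real_power)
      qed simp
    qed
  qed
  have term_lim: "(\<lambda>k. if i < N k - a k then ?T k i else 0)
      \<longlonglongrightarrow> exp (- (1 / 2) * of_real \<beta> * (of_nat (Suc i))\<^sup>2 + w * of_nat (Suc i))" for i
  proof -
    have "(\<lambda>k. ?T k i) \<longlonglongrightarrow>
       exp (of_nat (Suc i) * (w - of_real (\<beta> / 2))) * of_real (exp (- \<beta> * (real i * (real i + 1) / 2)))"
      by (intro tendsto_intros up_prod_Suc_power_tendsto a lim \<zeta>)
    \<comment> \<open>Term i lies i + 1 steps above the reference term, and i(i+1)/2 + (i+1)/2 =
      (i+1)^2/2.\<close>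
    also have "exp (of_nat (Suc i) * (w - of_real (\<beta> / 2))) * of_real (exp (- \<beta> * (real i * (real i + 1) / 2))) =
        exp (- (1 / 2) * of_real \<beta> * (of_nat (Suc i))\<^sup>2 + w * of_nat (Suc i))"
      unfolding exp_of_real[symmetric] exp_add[symmetric]
      by (rule arg_cong[of _ _ exp]) (simp add: field_simps power2_eq_square)
    finally have lim_T: "(\<lambda>k. ?T k i) \<longlonglongrightarrow> exp (- (1 / 2) * of_real \<beta> * (of_nat (Suc i))\<^sup>2 + w * of_nat (Suc i))" .
    have "\<forall>\<^sub>F k in sequentially. i < N k - a k"
      using filterlim_at_top[THEN iffD1, OF N, rule_format, of "Suc i"] by (simp add: Suc_le_eq)
    then have "\<forall>\<^sub>F k in sequentially. ?T k i = (if i < N k - a k then ?T k i else 0)"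
      by eventually_elim simp
    from Lim_transform_eventually[OF lim_T this] show ?thesis .
  qed
  have "summable (\<lambda>i. exp R * exp (R * real i - \<beta> / (4 * B) * (real i)\<^sup>2))"
    using \<beta> B by (intro summable_mult summable_gaussian) simp
  from suminf_tendsto_dominated[OF term_lim bound this] show ?A ?B .
qed

lemma infsum_int_split:
  fixes g :: "int \<Rightarrow> complex"
  assumes "summable (\<lambda>m. norm (g (int m)))" "summable (\<lambda>i. norm (g (- int (Suc i))))"
  shows "(\<Sum>\<^sub>\<infinity>j. g j) = (\<Sum>m. g (int m)) + (\<Sum>i. g (- int (Suc i)))"
proof -
  have "((\<lambda>m. g (int m)) has_sum (\<Sum>m. g (int m))) UNIV"
    by (rule norm_summable_imp_has_sum[OF assms(1) summable_sums[OF summable_norm_cancel[OF assms(1)]]])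
  then have nonneg: "(g has_sum (\<Sum>m. g (int m))) (range int)"
    by (intro has_sum_reindex[THEN iffD2]) (simp_all add: o_def)
  have "((\<lambda>i. g (- int (Suc i))) has_sum (\<Sum>i. g (- int (Suc i)))) UNIV"
    by (rule norm_summable_imp_has_sum[OF assms(2) summable_sums[OF summable_norm_cancel[OF assms(2)]]])
  then have neg: "(g has_sum (\<Sum>i. g (- int (Suc i)))) (range (\<lambda>i. - int (Suc i)))"
    by (intro has_sum_reindex[THEN iffD2]) (simp_all add: o_def inj_on_def)
  have "(g has_sum ((\<Sum>m. g (int m)) + (\<Sum>i. g (- int (Suc i))))) (range int \<union> range (\<lambda>i. - int (Suc i)))"
    by (rule has_sum_Un_disjoint[OF nonneg neg]) auto
  also have "range int \<union> range (\<lambda>i. - int (Suc i)) = UNIV"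
  proof -
    have "j \<in> range int \<union> range (\<lambda>i. - int (Suc i))" for j
      by (cases j rule: int_cases) auto
    then show ?thesis by blast
  qed
  finally show ?thesis by (rule infsumI)
qed

section \<open>The critical regime\<close>

text \<open>A positive factor does not change the argument, so no branch is crossed. The weights can
  thus be normalized under \<open>csqrt\<close> while they are only known as complex
  numbers.\<close>

lemma csqrt_mult_of_real:
  assumes "t > 0"
  shows "csqrt (z * of_real t) = csqrt z * of_real (sqrt t)"
proof (rule csqrt_unique)
  have "(csqrt z * of_real (sqrt t))\<^sup>2 = z * of_real ((sqrt t)\<^sup>2)"
    by (simp only: power_mult_distrib power2_csqrt of_real_power)
  then show "(csqrt z * of_real (sqrt t))\<^sup>2 = z * of_real t"
    using assms by simp
  show "0 < Re (csqrt z * of_real (sqrt t)) \<or>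
      Re (csqrt z * of_real (sqrt t)) = 0 \<and> 0 \<le> Im (csqrt z * of_real (sqrt t))"
    using csqrt_principal[of z] assms by (auto simp: zero_less_mult_iff)
qed

text \<open>The error of Ln(1 + h) against h is at most |h|^2/(1 - |h|), and M |h| stays bounded
  while h tends to 0.\<close>

lemma of_nat_mult_Ln_tendsto:
  assumes h: "h \<longlonglongrightarrow> 0" and Mh: "(\<lambda>k. of_nat (M k) * h k) \<longlonglongrightarrow> w"
  shows "(\<lambda>k. of_nat (M k) * Ln (1 + h k)) \<longlonglongrightarrow> w"
proof -
  have "(\<lambda>k. norm (of_nat (M k) * h k) * (norm (h k) / (1 - norm (h k)))) \<longlonglongrightarrow> norm w * (norm (0::complex) / (1 - norm (0::complex)))"
    by (intro tendsto_intros h Mh) auto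
  then have small: "(\<lambda>k. norm (of_nat (M k) * h k) * (norm (h k) / (1 - norm (h k)))) \<longlonglongrightarrow> 0"
    by simp
  have "\<forall>\<^sub>F k in sequentially. norm (h k) < 1"
    using order_tendstoD(2)[OF tendsto_norm[OF h], of 1] by simp
  then have "\<forall>\<^sub>F k in sequentially. norm (of_nat (M k) * (Ln (1 + h k) - h k)) \<le>
      norm (of_nat (M k) * h k) * (norm (h k) / (1 - norm (h k)))"
  proof eventually_elim
    case (elim k)
    have "norm (Ln (1 + h k) - h k) \<le> (norm (h k))\<^sup>2 / (1 - norm (h k))"
      by (rule Ln_approx_linear[OF elim])
    then have "real (M k) * norm (Ln (1 + h k) - h k) \<le> real (M k) * ((norm (h k))\<^sup>2 / (1 - norm (h k)))"
      by (rule mult_left_mono) simp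
    then show ?case by (simp add: norm_mult power2_eq_square mult_ac)
  qed
  then have "(\<lambda>k. of_nat (M k) * (Ln (1 + h k) - h k)) \<longlonglongrightarrow> 0"
    by (rule Lim_null_comparison[OF _ small])
  from tendsto_add[OF this Mh] show ?thesis
    by (simp add: algebra_simps)
qed

text \<open>In |z| z^(a-1) = |z|^a sgn(z)^(a-1) the modulus goes under the square root, where it
  normalizes the weights together with the Gamma(a)^M from the reference term; the unimodular part
  stays outside as a row or column factor.\<close>

lemma ginibre_kernel_scaled:
  fixes c :: real and \<zeta> :: complex
  assumes a: "1 \<le> a" "a \<le> N" and M: "M \<ge> 1" and y: "z1 * cnj z2 = of_nat a ^ M * exp \<zeta>"
    and z: "z1 \<noteq> 0" "z2 \<noteq> 0"
  defines "W \<equiv> \<lambda>z. ginibre_weight c M z * of_real (cmod z ^ (2 * a) / Gamma (real a) ^ M)"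
  shows "of_real (cmod z1) * ginibre_kernel c M N z1 z2 * of_real (cmod z2) =
    sgn z1 ^ (a - 1) * (1 / of_real pi * csqrt (W z1 * W z2) *
     ((\<Sum>m. exp (- of_nat m * \<zeta>) * of_real (down_prod a m ^ M)) +
      (\<Sum>i. if i < N - a then exp (of_nat (Suc i) * \<zeta>) * of_real (up_prod a (Suc i) ^ M) else 0))) *
     cnj (sgn z2) ^ (a - 1)"
proof -
  have pos: "Gamma (real a) > 0" using a by (intro Gamma_real_pos) auto
  define g where "g = Gamma (real a) ^ M"
  have g: "g > 0" using pos by (simp add: g_def)
  define r where "r = cmod z1 ^ (2 * a) / g * (cmod z2 ^ (2 * a) / g)"
  have r: "r > 0" using g z by (simp add: r_def)
  have r_sq: "r = (cmod z1 ^ a * cmod z2 ^ a / g)\<^sup>2"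
    by (simp add: r_def power_mult_distrib power_divide power_mult[symmetric] power2_eq_square[of g] mult.commute)
  have sqrt_r: "sqrt r = cmod z1 ^ a * cmod z2 ^ a / g"
    unfolding r_sq using g by (intro real_sqrt_unique) auto
  have "W z1 * W z2 = ginibre_weight c M z1 * ginibre_weight c M z2 * of_real r"
    unfolding W_def r_def g_def by (simp only: of_real_mult mult_ac)
  then have csqrt_W: "csqrt (W z1 * W z2) =
      csqrt (ginibre_weight c M z1 * ginibre_weight c M z2) * of_real (cmod z1 ^ a * cmod z2 ^ a / g)"
    unfolding sqrt_r[symmetric] using csqrt_mult_of_real[OF r] by simp
  have pow: "of_real (cmod z) * z ^ (a - 1) = of_real (cmod z ^ a) * sgn z ^ (a - 1)" for z :: complex
  proof -
    have "of_real (cmod z) * sgn z = z" by (cases "z = 0") (simp_all add: sgn_eq)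
    then have "z ^ (a - 1) = (of_real (cmod z) * sgn z) ^ (a - 1)" by simp
    moreover have "of_real (cmod z ^ a) = complex_of_real (cmod z) * of_real (cmod z) ^ (a - 1)"
      using a by (simp flip: power_Suc)
    ultimately show ?thesis by (simp only: power_mult_distrib mult.assoc)
  qed
  have pow2: "of_real (cmod z2) * cnj z2 ^ (a - 1) = of_real (cmod z2 ^ a) * cnj (sgn z2) ^ (a - 1)"
    using arg_cong[OF pow[of z2], of cnj] by simp
  define T where "T = (\<Sum>m. exp (- of_nat m * \<zeta>) * of_real (down_prod a m ^ M)) +
      (\<Sum>i. if i < N - a then exp (of_nat (Suc i) * \<zeta>) * of_real (up_prod a (Suc i) ^ M) else 0)"
  define w where "w = csqrt (ginibre_weight c M z1 * ginibre_weight c M z2)"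
  have "ginibre_kernel c M N z1 z2 = 1 / of_real pi * w * ((z1 * cnj z2) ^ (a - 1) / of_real g * T)"
    unfolding ginibre_kernel_def ginibre_sum_split[OF a M y] w_def T_def g_def of_real_power ..
  then have "of_real (cmod z1) * ginibre_kernel c M N z1 z2 * of_real (cmod z2) =
      1 / of_real pi * w * ((of_real (cmod z1) * z1 ^ (a - 1)) * (of_real (cmod z2) * cnj z2 ^ (a - 1)) / of_real g) * T"
    by (simp only: power_mult_distrib divide_inverse mult_ac)
  also have "\<dots> = sgn z1 ^ (a - 1) * (1 / of_real pi * (w * of_real (cmod z1 ^ a * cmod z2 ^ a / g)) * T) * cnj (sgn z2) ^ (a - 1)"
    unfolding pow pow2 by (simp add: divide_inverse mult_ac)
  finally show ?thesis
    unfolding csqrt_W w_def T_def .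
qed

text \<open>Since |x|^2 + x^2 = 2 (Re x)^2 + i Im(x^2), the exponential is a real Gaussian in the
  real parts times a phase in x and the conjugate phase in y.\<close>

lemma crit_prefactor_eq:
  assumes "\<beta> > 0"
  defines "p \<equiv> \<lambda>x. exp (- \<i> * of_real (Im (x\<^sup>2) / (2 * \<beta>)))"
  shows "crit_prefactor \<beta> x y = p x *
    (1 / of_real pi * of_real (exp (- ((Re x)\<^sup>2 + (Re y)\<^sup>2) / \<beta>) / sqrt (2 * pi * \<beta>))) * cnj (p y)"
proof -
  have exponent: "- (1 / (2 * complex_of_real \<beta>)) *
       (complex_of_real ((cmod x)\<^sup>2) + complex_of_real ((cmod y)\<^sup>2) + x\<^sup>2 + (cnj y)\<^sup>2) =
      (- \<i> * of_real (Im (x\<^sup>2) / (2 * \<beta>))) + of_real (- ((Re x)\<^sup>2 + (Re y)\<^sup>2) / \<beta>) +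
      cnj (- \<i> * of_real (Im (y\<^sup>2) / (2 * \<beta>)))"
  proof -
    have "- (1 / (2 * complex_of_real \<beta>)) = of_real (- (1 / (2 * \<beta>)))" by simp
    then show ?thesis
      using assms(1)
      by (simp add: complex_eq_iff Re_power2 Im_power2 cmod_power2 field_simps del: of_real_power)
  qed
  have "sqrt (2 * pi ^ 3 * \<beta>) = sqrt (pi\<^sup>2 * (2 * pi * \<beta>))"
    by (rule arg_cong[of _ _ sqrt]) (simp add: power2_eq_square power3_eq_cube)
  then have "sqrt (2 * pi ^ 3 * \<beta>) = pi * sqrt (2 * pi * \<beta>)"
    by (simp only: real_sqrt_mult real_sqrt_abs) simp
  then show ?thesis
    unfolding crit_prefactor_def exponent exp_add p_def exp_cnj exp_of_real by (simp add: mult_ac)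
qed

text \<open>Both series depend on the two points only through w, the sum of the first and the
  conjugate of the second; one name lets bulk and edge share the remaining argument.\<close>

definition crit_theta :: "real \<Rightarrow> real \<Rightarrow> complex \<Rightarrow> complex" where
  "crit_theta q \<beta> w = (if q = 0 then (\<Sum>m. exp (- (1 / 2) * of_real \<beta> * (of_nat m)\<^sup>2 - w * of_nat m))
     else (\<Sum>\<^sub>\<infinity>j\<in>(UNIV :: int set). exp (- (1 / 2) * of_real \<beta> * (of_int j)\<^sup>2 - w * of_int j)))"

section \<open>The scaling limit along a sequence\<close>

text \<open>The assumptions are stable under passing to a subsequence, so all results can be
  instantiated along M and N composed with a strictly increasing map. As \<open>u\<close> is indexed
  by the matrix size, it stays the same.\<close>

locale critical_regime =
  fixes \<gamma> q :: real and M N :: "nat \<Rightarrow> nat" and u :: "nat \<Rightarrow> complex"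
  assumes \<gamma>_pos: "\<gamma> > 0" and q: "0 \<le> q" "q < 1"
    and M_pos: "\<And>k. M k \<ge> 1" and N_pos: "\<And>k. N k \<ge> 1"
    and N_top: "filterlim N at_top sequentially"
    and ratio: "(\<lambda>k. real (M k) / real (N k)) \<longlonglongrightarrow> \<gamma>"
    and u_norm: "\<And>k. (cmod (u (N k)))\<^sup>2 = 1 - 1 / real (N k) * real_of_int \<lfloor>q * real (N k)\<rfloor>"
begin

definition a :: "nat \<Rightarrow> nat" where "a k = N k - nat \<lfloor>q * real (N k)\<rfloor>"

definition \<beta> :: real where "\<beta> = \<gamma> / (1 - q)"

lemma \<beta>_pos: "\<beta> > 0"
  using \<gamma>_pos q by (simp add: \<beta>_def)

lemma floor_bounds: "0 \<le> \<lfloor>q * real (N k)\<rfloor>" "\<lfloor>q * real (N k)\<rfloor> < int (N k)"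
proof -
  have "q * real (N k) < 1 * real (N k)"
    using q N_pos[of k] by (intro mult_strict_right_mono) auto
  then show "\<lfloor>q * real (N k)\<rfloor> < int (N k)" by (simp add: floor_less_iff)
qed (use q in simp)

lemma real_a: "real (a k) = real (N k) - real_of_int \<lfloor>q * real (N k)\<rfloor>"
  using floor_bounds[of k] by (simp add: a_def of_nat_diff nat_le_iff)

lemma a_ge_1: "a k \<ge> 1" and a_le_N: "a k \<le> N k"
  using nat_less_iff[THEN iffD2, OF floor_bounds[of k]] by (auto simp: a_def)

lemma N_minus_a: "N k - a k = nat \<lfloor>q * real (N k)\<rfloor>"
  using nat_less_iff[THEN iffD2, OF floor_bounds[of k]] by (auto simp: a_def)

lemma a_lower: "(1 - q) * real (N k) \<le> real (a k)"
  using of_int_floor_le[of "q * real (N k)"] unfolding real_a by (simp add: algebra_simps)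

lemma a_upper: "real (a k) \<le> (1 - q) * real (N k) + 1"
  using real_of_int_floor_add_one_ge[of "q * real (N k)"] unfolding real_a by (simp add: algebra_simps)

lemma N_real_top: "filterlim (\<lambda>k. real (N k)) at_top sequentially"
  by (rule filterlim_compose[OF filterlim_real_sequentially N_top])

lemma M_real_top: "filterlim (\<lambda>k. real (M k)) at_top sequentially"
proof -
  have "filterlim (\<lambda>k. real (M k) / real (N k) * real (N k)) at_top sequentially"
    by (rule filterlim_tendsto_pos_mult_at_top[OF ratio \<gamma>_pos N_real_top])
  moreover have "real (M k) / real (N k) * real (N k) = real (M k)" for k
    using N_pos[of k] by simp
  ultimately show ?thesis by simp
qed

lemma a_top: "filterlim a at_top sequentially"
proof -
  have "filterlim (\<lambda>k. (1 - q) * real (N k)) at_top sequentially"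
    using q by (intro filterlim_tendsto_pos_mult_at_top[OF tendsto_const _ N_real_top]) auto
  then have "filterlim (\<lambda>k. real (a k)) at_top sequentially"
    by (rule filterlim_at_top_mono) (simp add: a_lower)
  then show ?thesis by (simp add: filterlim_sequentially_iff_filterlim_real)
qed

lemma M_over_a: "(\<lambda>k. real (M k) / real (a k)) \<longlonglongrightarrow> \<beta>"
proof -
  have inv_N: "(\<lambda>k. 1 / real (N k)) \<longlonglongrightarrow> 0"
    by (rule tendsto_divide_0[OF tendsto_const filterlim_at_top_imp_at_infinity[OF N_real_top]])
  have "(\<lambda>k. real (a k) / real (N k)) \<longlonglongrightarrow> 1 - q"
  proof (rule tendsto_sandwich[OF _ _ tendsto_const])
    have "(\<lambda>k. (1 - q) + 1 / real (N k)) \<longlonglongrightarrow> (1 - q) + 0" by (intro tendsto_intros inv_N)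
    then show "(\<lambda>k. (1 - q) + 1 / real (N k)) \<longlonglongrightarrow> 1 - q" by simp
    have "1 - q \<le> real (a k) / real (N k)" "real (a k) / real (N k) \<le> (1 - q) + 1 / real (N k)" for k
      using a_lower[of k] a_upper[of k] N_pos[of k] by (auto simp: field_simps)
    then show "\<forall>\<^sub>F k in sequentially. 1 - q \<le> real (a k) / real (N k)"
      "\<forall>\<^sub>F k in sequentially. real (a k) / real (N k) \<le> (1 - q) + 1 / real (N k)" by auto
  qed
  with ratio have "(\<lambda>k. real (M k) / real (N k) / (real (a k) / real (N k))) \<longlonglongrightarrow> \<gamma> / (1 - q)"
    using q by (intro tendsto_divide) auto
  moreover have "real (M k) / real (N k) / (real (a k) / real (N k)) = real (M k) / real (a k)" for k
    using N_pos[of k] by simp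
  ultimately show ?thesis by (simp only: \<beta>_def)
qed

definition f :: "nat \<Rightarrow> complex \<Rightarrow> complex" where
  "f k v = 1 + 1 / complex_of_real (sqrt (\<gamma> * real (M k) * real (N k))) *
        (v - complex_of_real (\<gamma> / (4 * (1 - q))))"

definition z :: "nat \<Rightarrow> complex \<Rightarrow> complex" where
  "z k v = crit_point \<gamma> q u (M k) (N k) v"

text \<open>The exponent M is an integer, so \<open>exp (\<Lambda> k v)\<close> is the M-th power of
  \<open>f k v\<close> whatever the branch, provided \<open>f k v\<close> is nonzero. This condition
  holds eventually along convergent v and accompanies all identities below.\<close>

definition \<Lambda> :: "nat \<Rightarrow> complex \<Rightarrow> complex" where
  "\<Lambda> k v = of_nat (M k) * Ln (f k v)"

lemma amplitude_sq: "(cmod (complex_of_real (sqrt (real (N k))) * u (N k)))\<^sup>2 = real (a k)"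
  using N_pos[of k]
  by (simp add: norm_mult power_mult_distrib u_norm real_a field_simps)

text \<open>Explains the scale in z_j: the M-th power multiplies the displacement by M, and M
  divided by sqrt (\<gamma> M N) is sqrt (M/(N \<gamma>)).\<close>

lemma scale_tendsto: "(\<lambda>k. real (M k) / sqrt (\<gamma> * real (M k) * real (N k))) \<longlonglongrightarrow> 1"
proof -
  have "(\<lambda>k. sqrt (real (M k) / real (N k) / \<gamma>)) \<longlonglongrightarrow> sqrt (\<gamma> / \<gamma>)"
    using \<gamma>_pos by (intro tendsto_intros ratio) auto
  moreover have "sqrt (real (M k) / real (N k) / \<gamma>) = real (M k) / sqrt (\<gamma> * real (M k) * real (N k))" for k
  proof -
    have "real (M k) / real (N k) / \<gamma> = (real (M k))\<^sup>2 / (\<gamma> * real (M k) * real (N k))"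
      using M_pos[of k] by (simp add: power2_eq_square)
    then show ?thesis by (simp add: real_sqrt_divide)
  qed
  ultimately show ?thesis using \<gamma>_pos by simp
qed

lemma f_tendsto:
  assumes v: "v \<longlonglongrightarrow> x"
  shows "(\<lambda>k. f k (v k)) \<longlonglongrightarrow> 1" "(\<lambda>k. \<Lambda> k (v k)) \<longlonglongrightarrow> x - of_real (\<beta> / 4)"
proof -
  define b where "b = complex_of_real (\<gamma> / (4 * (1 - q)))"
  define h where "h k = 1 / complex_of_real (sqrt (\<gamma> * real (M k) * real (N k))) * (v k - b)" for k
  have f_eq: "f k (v k) = 1 + h k" for k by (simp add: f_def h_def b_def)
  have "(\<lambda>k. of_real (real (M k) / sqrt (\<gamma> * real (M k) * real (N k))) * (v k - b)) \<longlonglongrightarrow> of_real 1 * (x - b)"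
    by (intro tendsto_intros scale_tendsto v)
  moreover have "of_real (real (M k) / sqrt (\<gamma> * real (M k) * real (N k))) * (v k - b) = of_nat (M k) * h k" for k
    by (simp add: h_def)
  ultimately have Mh: "(\<lambda>k. of_nat (M k) * h k) \<longlonglongrightarrow> x - b" by simp
  have "(\<lambda>k. 1 / real (M k)) \<longlonglongrightarrow> 0"
    by (rule tendsto_divide_0[OF tendsto_const filterlim_at_top_imp_at_infinity[OF M_real_top]])
  from tendsto_mult[OF tendsto_of_real[OF this] Mh]
  have "(\<lambda>k. of_real (1 / real (M k)) * (of_nat (M k) * h k)) \<longlonglongrightarrow> 0" by simp
  moreover have "of_real (1 / real (M k)) * (of_nat (M k) * h k) = h k" for k
    using M_pos[of k] by simp
  ultimately have h: "h \<longlonglongrightarrow> 0" by simp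
  from tendsto_add[OF tendsto_const this, of 1] show "(\<lambda>k. f k (v k)) \<longlonglongrightarrow> 1"
    by (simp add: f_eq)
  have "b = of_real (\<beta> / 4)" by (simp add: b_def \<beta>_def mult.commute)
  then show "(\<lambda>k. \<Lambda> k (v k)) \<longlonglongrightarrow> x - of_real (\<beta> / 4)"
    using of_nat_mult_Ln_tendsto[OF h Mh] by (simp only: \<Lambda>_def f_eq)
qed

lemma f_nonzero:
  assumes "v \<longlonglongrightarrow> x"
  shows "\<forall>\<^sub>F k in sequentially. f k (v k) \<noteq> 0"
  by (rule tendsto_imp_eventually_ne[OF f_tendsto(1)[OF assms]]) simp

lemma z_eq:
  assumes "f k v \<noteq> 0"
  shows "z k v = (complex_of_real (sqrt (real (N k))) * u (N k)) ^ M k * exp (\<Lambda> k v)"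
proof -
  have "exp (\<Lambda> k v) = f k v ^ M k"
    using assms by (simp add: \<Lambda>_def exp_of_nat_mult)
  then show ?thesis by (simp only: z_def crit_point_def f_def)
qed

lemma z_nonzero:
  assumes "f k v \<noteq> 0"
  shows "z k v \<noteq> 0"
  using amplitude_sq[of k] a_ge_1[of k] N_pos[of k] by (auto simp: z_eq[OF assms])

lemma ln_norm_z:
  assumes "f k v \<noteq> 0"
  shows "2 * ln (cmod (z k v)) - real (M k) * ln (real (a k)) = 2 * Re (\<Lambda> k v)"
proof -
  define A where "A = cmod (complex_of_real (sqrt (real (N k))) * u (N k))"
  have A: "A\<^sup>2 = real (a k)" "A > 0"
    using amplitude_sq[of k] a_ge_1[of k] N_pos[of k] by (auto simp: A_def)
  have "cmod (z k v) = A ^ M k * exp (Re (\<Lambda> k v))"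
    unfolding z_eq[OF assms] by (simp add: norm_mult norm_power A_def)
  then have "ln (cmod (z k v)) = real (M k) * ln A + Re (\<Lambda> k v)"
    using A by (simp add: ln_mult ln_realpow)
  moreover have "ln (real (a k)) = 2 * ln A"
    unfolding A(1)[symmetric] using A(2) by (simp add: ln_realpow)
  ultimately show ?thesis by simp
qed

lemma z_mult_cnj:
  assumes "f k v \<noteq> 0" "f k w \<noteq> 0"
  shows "z k v * cnj (z k w) = of_nat (a k) ^ M k * exp (\<Lambda> k v + cnj (\<Lambda> k w))"
proof -
  define A where "A = complex_of_real (sqrt (real (N k))) * u (N k)"
  have "A * cnj A = of_nat (a k)"
    using amplitude_sq[of k] by (simp add: A_def[symmetric] complex_norm_square[symmetric])
  then have "of_nat (a k) ^ M k = A ^ M k * cnj A ^ M k"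
    by (metis power_mult_distrib)
  then show ?thesis
    unfolding z_eq[OF assms(1)] z_eq[OF assms(2)] A_def[symmetric]
    by (simp add: exp_add exp_cnj mult_ac)
qed

definition W :: "real \<Rightarrow> nat \<Rightarrow> complex \<Rightarrow> complex" where
  "W c k v = ginibre_weight c (M k) (z k v) *
     of_real (cmod (z k v) ^ (2 * a k) / Gamma (real (a k)) ^ M k)"

lemma W_tendsto:
  assumes c: "c > 0" and v: "v \<longlonglongrightarrow> x"
  shows "(\<lambda>k. W c k (v k)) \<longlonglongrightarrow> of_real (exp (- (2 * Re x)\<^sup>2 / (2 * \<beta>)) / sqrt (2 * pi * \<beta>))"
proof -
  have "(\<lambda>k. 2 * Re (\<Lambda> k (v k))) \<longlonglongrightarrow> 2 * Re (x - of_real (\<beta> / 4))"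
    by (intro tendsto_intros f_tendsto v)
  moreover have "\<forall>\<^sub>F k in sequentially. 2 * Re (\<Lambda> k (v k)) =
      2 * ln (cmod (z k (v k))) - real (M k) * ln (real (a k))"
    using f_nonzero[OF v] by eventually_elim (simp add: ln_norm_z)
  ultimately have s: "(\<lambda>k. 2 * ln (cmod (z k (v k))) - real (M k) * ln (real (a k)))
      \<longlonglongrightarrow> 2 * Re (x - of_real (\<beta> / 4))"
    by (rule Lim_transform_eventually)
  have "\<forall>\<^sub>F k in sequentially. z k (v k) \<noteq> 0"
    using f_nonzero[OF v] by eventually_elim (rule z_nonzero)
  from ginibre_weight_tendsto[OF a_top a_ge_1 M_pos c \<beta>_pos M_over_a this s]
  have "(\<lambda>k. W c k (v k)) \<longlonglongrightarrow>
      of_real (exp (- (2 * Re (x - of_real (\<beta> / 4)) + \<beta> / 2)\<^sup>2 / (2 * \<beta>)) / sqrt (2 * pi * \<beta>))"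
    by (simp only: W_def)
  \<comment> \<open>Twice the \<beta>/4 from the rescaling cancels the \<beta>/2 from the linear
    phase.\<close>
  moreover have "2 * Re (x - of_real (\<beta> / 4)) + \<beta> / 2 = 2 * Re x" by simp
  ultimately show ?thesis by (simp only:)
qed

lemma csqrt_W_tendsto:
  assumes c: "c > 0" and v: "v \<longlonglongrightarrow> x" and w: "w \<longlonglongrightarrow> y"
  shows "(\<lambda>k. csqrt (W c k (v k) * W c k (w k))) \<longlonglongrightarrow>
    of_real (exp (- ((Re x)\<^sup>2 + (Re y)\<^sup>2) / \<beta>) / sqrt (2 * pi * \<beta>))"
proof -
  define L where "L x = exp (- (2 * Re x)\<^sup>2 / (2 * \<beta>)) / sqrt (2 * pi * \<beta>)" for x
  define m where "m = exp (- ((Re x)\<^sup>2 + (Re y)\<^sup>2) / \<beta>) / sqrt (2 * pi * \<beta>)"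
  have m: "m > 0" using \<beta>_pos by (simp add: m_def)
  have "- (2 * Re x)\<^sup>2 / (2 * \<beta>) + - (2 * Re y)\<^sup>2 / (2 * \<beta>) = 2 * (- ((Re x)\<^sup>2 + (Re y)\<^sup>2) / \<beta>)"
    using \<beta>_pos by (simp add: field_simps power_mult_distrib)
  then have "exp (- (2 * Re x)\<^sup>2 / (2 * \<beta>)) * exp (- (2 * Re y)\<^sup>2 / (2 * \<beta>)) = (exp (- ((Re x)\<^sup>2 + (Re y)\<^sup>2) / \<beta>))\<^sup>2"
    by (simp only: exp_add[symmetric] exp_double[symmetric])
  then have "L x * L y = m\<^sup>2"
    unfolding L_def m_def by (simp only: times_divide_times_eq power_divide power2_eq_square)
  then have "(\<lambda>k. W c k (v k) * W c k (w k)) \<longlonglongrightarrow> of_real (m\<^sup>2)"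
    using tendsto_mult[OF W_tendsto[OF c v] W_tendsto[OF c w]] by (simp only: L_def of_real_mult[symmetric])
  \<comment> \<open>The limit is a positive real, hence away from the branch cut.\<close>
  moreover have "isCont csqrt (of_real (m\<^sup>2))"
    using m by (intro isCont_csqrt') (auto simp: complex_nonpos_Reals_iff)
  ultimately have "(\<lambda>k. csqrt (W c k (v k) * W c k (w k))) \<longlonglongrightarrow> csqrt (of_real (m\<^sup>2))"
    by (intro isCont_tendsto_compose[of _ csqrt])
  also have "csqrt (of_real (m\<^sup>2)) = of_real m"
    using m by (simp add: csqrt_of_real_nonneg del: of_real_power)
  finally show ?thesis by (simp only: m_def)
qed

definition S :: "nat \<Rightarrow> complex \<Rightarrow> complex" where
  "S k \<zeta> = (\<Sum>m. exp (- of_nat m * \<zeta>) * of_real (down_prod (a k) m ^ M k)) +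
     (\<Sum>i. if i < N k - a k then exp (of_nat (Suc i) * \<zeta>) * of_real (up_prod (a k) (Suc i) ^ M k) else 0)"

lemma S_tendsto:
  assumes \<zeta>: "\<zeta> \<longlonglongrightarrow> w - of_real (\<beta> / 2)"
  shows "(\<lambda>k. S k (\<zeta> k)) \<longlonglongrightarrow> crit_theta q \<beta> w"
proof (cases "q = 0")
  case True
  \<comment> \<open>At the edge a = N, so the reference term is the last of the sum and nothing lies
    above it.\<close>
  then have "N k - a k = 0" for k unfolding N_minus_a by simp
  then have S_eq: "S k \<zeta> = (\<Sum>m. exp (- of_nat m * \<zeta>) * of_real (down_prod (a k) m ^ M k))" for k \<zeta>
    by (simp add: S_def)
  show ?thesis
    unfolding S_eq crit_theta_def if_P[OF True]
    by (rule down_sum_tendsto(1)[OF a_top a_ge_1 M_pos M_over_a \<beta>_pos \<zeta>])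
next
  case False
  have "filterlim (\<lambda>k. q * real (N k)) at_top sequentially"
    using False q by (intro filterlim_tendsto_pos_mult_at_top[OF tendsto_const _ N_real_top]) auto
  then have N_a: "filterlim (\<lambda>k. N k - a k) at_top sequentially"
    unfolding N_minus_a
    by (intro filterlim_compose[OF filterlim_nat_sequentially] filterlim_compose[OF filterlim_floor_sequentially])
  \<comment> \<open>As a >= (1 - q) N, the number 1/(1 - q) bounds N/a; it is the loss in the decay
    of the upper terms.\<close>
  have B: "1 / (1 - q) > 0" "\<forall>\<^sub>F k in sequentially. real (N k) \<le> 1 / (1 - q) * real (a k)"
    using q a_lower by (auto simp: field_simps)
  note down = down_sum_tendsto[OF a_top a_ge_1 M_pos M_over_a \<beta>_pos \<zeta>]
  note up = up_sum_tendsto[OF a_top a_ge_1 M_over_a \<beta>_pos \<zeta> N_a B]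
  define g where "g j = exp (- (1 / 2) * of_real \<beta> * (of_int j)\<^sup>2 - w * of_int j)" for j :: int
  have g_nat: "g (int m) = exp (- (1 / 2) * of_real \<beta> * (of_nat m)\<^sup>2 - w * of_nat m)" for m
    by (simp add: g_def)
  have g_neg: "g (- int (Suc i)) = exp (- (1 / 2) * of_real \<beta> * (of_nat (Suc i))\<^sup>2 + w * of_nat (Suc i))" for i
    unfolding g_def by (rule arg_cong[of _ _ exp]) (simp add: power2_eq_square algebra_simps)
  have "(\<Sum>\<^sub>\<infinity>j. g j) = (\<Sum>m. g (int m)) + (\<Sum>i. g (- int (Suc i)))"
    by (rule infsum_int_split) (use down(2) up(2) in \<open>simp_all only: g_nat g_neg\<close>)
  then have "crit_theta q \<beta> w = (\<Sum>m. g (int m)) + (\<Sum>i. g (- int (Suc i)))"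
    using False by (simp add: crit_theta_def g_def)
  then show ?thesis
    using tendsto_add[OF down(1) up(1)] by (simp only: S_def g_nat g_neg)
qed

text \<open>Entries of the rescaled kernel matrix need not converge, because of the phases
  sgn(z)^(a-1). The limit is therefore taken for the phase-free matrix \<open>G\<close>, and the
  phases on either side are reinserted by unimodular row and column factors.\<close>

lemma kernel_det_tendsto:
  assumes c: "c > 0" and v: "\<And>i. i < n \<Longrightarrow> (\<lambda>k. v k i) \<longlonglongrightarrow> x i"
  shows "(\<lambda>k. of_real ((cmod (\<Prod>i<n. z k (v k i)))\<^sup>2) *
            kernel_det (ginibre_kernel c (M k) (N k)) n (\<lambda>i. z k (v k i))) \<longlonglongrightarrow>
         (if q = 0 then kernel_det (crit_edge_kernel \<gamma>) n x
          else kernel_det (crit_bulk_kernel (\<gamma> / (1 - q))) n x)"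
proof -
  define G where "G k i j = 1 / of_real pi * csqrt (W c k (v k i) * W c k (v k j)) *
      S k (\<Lambda> k (v k i) + cnj (\<Lambda> k (v k j)))" for k i j
  define H where "H i j = 1 / of_real pi *
      of_real (exp (- ((Re (x i))\<^sup>2 + (Re (x j))\<^sup>2) / \<beta>) / sqrt (2 * pi * \<beta>)) *
      crit_theta q \<beta> (x i + cnj (x j))" for i j
  have "(\<lambda>k. G k i j) \<longlonglongrightarrow> H i j" if ij: "i < n" "j < n" for i j
  proof -
    have "(\<lambda>k. \<Lambda> k (v k i) + cnj (\<Lambda> k (v k j))) \<longlonglongrightarrow>
        (x i - of_real (\<beta> / 4)) + cnj (x j - of_real (\<beta> / 4))"
      by (intro tendsto_intros f_tendsto v ij)
    then have "(\<lambda>k. \<Lambda> k (v k i) + cnj (\<Lambda> k (v k j))) \<longlonglongrightarrow> (x i + cnj (x j)) - of_real (\<beta> / 2)"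
      by (simp add: algebra_simps)
    then show ?thesis
      unfolding G_def H_def by (intro tendsto_intros csqrt_W_tendsto S_tendsto c v ij)
  qed
  then have "(\<lambda>k. Determinant.det (mat n n (\<lambda>(i, j). G k i j))) \<longlonglongrightarrow> Determinant.det (mat n n (\<lambda>(i, j). H i j))"
    by (rule tendsto_det)
  moreover have "Determinant.det (mat n n (\<lambda>(i, j). H i j)) =
      (if q = 0 then kernel_det (crit_edge_kernel \<gamma>) n x
       else kernel_det (crit_bulk_kernel (\<gamma> / (1 - q))) n x)"
  proof -
    define p where "p i = exp (- \<i> * of_real (Im ((x i)\<^sup>2) / (2 * \<beta>)))" for i
    have "p i * cnj (p i) = 1" for i
      unfolding p_def exp_cnj exp_add[symmetric] by simp
    then have "Determinant.det (mat n n (\<lambda>(i, j). p i * H i j * cnj (p j))) = Determinant.det (mat n n (\<lambda>(i, j). H i j))"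
      unfolding det_scale_rows_cols by simp
    moreover have "p i * H i j * cnj (p j) = crit_prefactor \<beta> (x i) (x j) * crit_theta q \<beta> (x i + cnj (x j))" for i j
      unfolding crit_prefactor_eq[OF \<beta>_pos] H_def p_def by (simp only: mult_ac)
    ultimately have det_H: "Determinant.det (mat n n (\<lambda>(i, j). H i j)) = Determinant.det (mat n n
        (\<lambda>(i, j). crit_prefactor \<beta> (x i) (x j) * crit_theta q \<beta> (x i + cnj (x j))))"
      by (simp only:)
    show ?thesis
    proof (cases "q = 0")
      case True
      then have "\<beta> = \<gamma>" unfolding \<beta>_def by simp
      then show ?thesis
        unfolding det_H by (simp only: if_P[OF True] kernel_det_def crit_edge_kernel_def crit_theta_def)
    next
      case False
      then show ?thesis
        unfolding det_H
        by (simp only: if_not_P kernel_det_def crit_bulk_kernel_def crit_theta_def \<beta>_def[symmetric] simp_thms)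
    qed
  qed
  moreover have "\<forall>\<^sub>F k in sequentially. Determinant.det (mat n n (\<lambda>(i, j). G k i j)) =
      of_real ((cmod (\<Prod>i<n. z k (v k i)))\<^sup>2) *
            kernel_det (ginibre_kernel c (M k) (N k)) n (\<lambda>i. z k (v k i))"
  proof -
    have "\<forall>\<^sub>F k in sequentially. \<forall>i\<in>{..<n}. f k (v k i) \<noteq> 0"
      by (intro eventually_ball_finite) (auto intro: f_nonzero[OF v])
    then show ?thesis
    proof eventually_elim
      case (elim k)
      define \<zeta> where "\<zeta> i = z k (v k i)" for i
      define d where "d i = sgn (\<zeta> i) ^ (a k - 1)" for i
      have nz: "\<zeta> i \<noteq> 0" if "i < n" for i using elim that by (simp add: \<zeta>_def z_nonzero)
      have unit: "d i * cnj (d i) = 1" if "i < n" for i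
      proof -
        have "cmod (d i) = 1" using nz[OF that] by (simp add: d_def norm_power norm_sgn)
        then show ?thesis using complex_norm_square[of "d i"] by simp
      qed
      have entry: "of_real (cmod (\<zeta> i)) * ginibre_kernel c (M k) (N k) (\<zeta> i) (\<zeta> j) * of_real (cmod (\<zeta> j)) =
          d i * G k i j * cnj (d j)" if ij: "i < n" "j < n" for i j
      proof -
        have fi: "f k (v k i) \<noteq> 0" and fj: "f k (v k j) \<noteq> 0" using elim ij by auto
        show ?thesis
          unfolding \<zeta>_def d_def G_def W_def S_def complex_cnj_power
          by (rule ginibre_kernel_scaled[OF a_ge_1 a_le_N M_pos z_mult_cnj[OF fi fj] z_nonzero[OF fi] z_nonzero[OF fj]])
      qed
      \<comment> \<open>Of the two factors |z_i| one goes to row i and one to column i.\<close>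
      have "of_real ((cmod (\<Prod>i<n. \<zeta> i))\<^sup>2) = (\<Prod>i<n. complex_of_real (cmod (\<zeta> i)) * of_real (cmod (\<zeta> i)))"
        by (simp add: prod_norm[symmetric] power2_eq_square prod.distrib)
      then have "of_real ((cmod (\<Prod>i<n. \<zeta> i))\<^sup>2) * kernel_det (ginibre_kernel c (M k) (N k)) n \<zeta> =
          Determinant.det (mat n n (\<lambda>(i, j). of_real (cmod (\<zeta> i)) * ginibre_kernel c (M k) (N k) (\<zeta> i) (\<zeta> j) * of_real (cmod (\<zeta> j))))"
        unfolding kernel_det_def det_scale_rows_cols by simp
      also have "mat n n (\<lambda>(i, j). of_real (cmod (\<zeta> i)) * ginibre_kernel c (M k) (N k) (\<zeta> i) (\<zeta> j) * of_real (cmod (\<zeta> j))) =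
          mat n n (\<lambda>(i, j). d i * G k i j * cnj (d j))"
        by (rule cong_mat) (auto simp: entry)
      also have "Determinant.det \<dots> = Determinant.det (mat n n (\<lambda>(i, j). G k i j))"
        unfolding det_scale_rows_cols using unit by simp
      finally show ?case by (simp add: \<zeta>_def)
    qed
  qed
  ultimately show ?thesis
    by (simp only:) (rule Lim_transform_eventually)
qed

lemma z_eventually_nonzero:
  fixes n :: nat
  assumes v: "\<And>i. i < n \<Longrightarrow> (\<lambda>k. v k i) \<longlonglongrightarrow> x i"
  shows "\<forall>\<^sub>F k in sequentially. \<forall>i<n. z k (v k i) \<noteq> 0"
proof -
  have "\<forall>\<^sub>F k in sequentially. \<forall>i\<in>{..<n}. f k (v k i) \<noteq> 0"
    by (intro eventually_ball_finite) (auto intro: f_nonzero[OF v])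
  then show ?thesis by eventually_elim (auto simp: z_nonzero)
qed

end

theorem theorem1p2:
  fixes n :: nat and c \<gamma> q \<theta> :: real
    and M N :: "nat \<Rightarrow> nat"
    and u :: "nat \<Rightarrow> complex"
    and P :: "nat \<Rightarrow> nat \<Rightarrow> 'w measure"
    and X :: "nat \<Rightarrow> nat \<Rightarrow> nat \<Rightarrow> 'w \<Rightarrow> complex mat"
    and R :: "nat \<Rightarrow> nat \<Rightarrow> (nat \<Rightarrow> complex) \<Rightarrow> complex"
    and C :: "complex set"
  assumes n: "n \<ge> 1" and c: "c > 0"
    and ginibre: "\<And>m d. m \<ge> 1 \<Longrightarrow> d \<ge> 1 \<Longrightarrow> ginibre_factors (P m d) m d (X m d)"
    and correlation: "\<And>m d. m \<ge> 1 \<Longrightarrow> d \<ge> 1 \<Longrightarrow>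
          is_eigenvalue_correlation (P m d) d (\<lambda>\<omega>. matrix_product d (\<lambda>l. X m d l \<omega>) m) n (R m d)"
    and determinantal: "\<And>m d z. m \<ge> 1 \<Longrightarrow> d \<ge> 1 \<Longrightarrow> (\<And>i. i < n \<Longrightarrow> z i \<noteq> 0) \<Longrightarrow>
          R m d z = kernel_det (ginibre_kernel c m d) n z"
    and M_pos: "\<And>k. M k \<ge> 1" and N_pos: "\<And>k. N k \<ge> 1"
    and M_plus_N: "filterlim (\<lambda>k. M k + N k) at_top sequentially"
    and gamma: "\<gamma> > 0" "(\<lambda>k. real (M k) / real (N k)) \<longlonglongrightarrow> \<gamma>"
    and q: "0 \<le> q" "q < 1"
    and theta: "\<theta> \<in> {-pi<..pi}"
    and u_arg: "\<And>d. d \<ge> 1 \<Longrightarrow> u d = complex_of_real (cmod (u d)) * exp (\<i> * complex_of_real \<theta>)"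
    and u_norm: "\<And>d. d \<ge> 1 \<Longrightarrow>
          (cmod (u d))\<^sup>2 = 1 - 1 / real d * real_of_int \<lfloor>q * real d\<rfloor>"
    and C: "compact C"
  shows "uniform_limit {v. \<forall>i<n. v i \<in> C}
     (\<lambda>k v. let z = (\<lambda>i. crit_point \<gamma> q u (M k) (N k) (v i))
            in complex_of_real ((cmod (\<Prod>i<n. z i))\<^sup>2) * R (M k) (N k) z)
     (\<lambda>v. if q = 0 then kernel_det (crit_edge_kernel \<gamma>) n v
          else kernel_det (crit_bulk_kernel (\<gamma> / (1 - q))) n v)
     sequentially"
proof -
  have N_top: "filterlim N at_top sequentially"
  proof -
    \<comment> \<open>Eventually M <= (\<gamma> + 1) N, so M + N <= (\<gamma> + 2) N and N alone
      tends to infinity.\<close>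
    have "\<forall>\<^sub>F k in sequentially. real (M k) / real (N k) < \<gamma> + 1"
      using gamma by (intro order_tendstoD(2)[OF gamma(2)]) simp
    then have bound: "\<forall>\<^sub>F k in sequentially. real (M k + N k) * (1 / (\<gamma> + 2)) \<le> real (N k)"
    proof eventually_elim
      case (elim k)
      then have "real (M k) \<le> (\<gamma> + 1) * real (N k)"
        using N_pos[of k] by (simp add: field_simps)
      then show ?case using gamma(1) by (simp add: field_simps)
    qed
    have "filterlim (\<lambda>k. real (M k + N k)) at_top sequentially"
      by (rule filterlim_compose[OF filterlim_real_sequentially M_plus_N])
    then have "filterlim (\<lambda>k. real (M k + N k) * (1 / (\<gamma> + 2))) at_top sequentially"
      using gamma(1) by (intro filterlim_at_top_mult_tendsto_pos[OF tendsto_const]) auto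
    then have "filterlim (\<lambda>k. real (N k)) at_top sequentially"
      by (rule filterlim_at_top_mono[OF _ bound])
    then show ?thesis by (simp add: filterlim_sequentially_iff_filterlim_real)
  qed
  show ?thesis
  proof (rule uniform_limit_from_continuous_convergence[OF C])
    fix \<sigma> :: "nat \<Rightarrow> nat" and v :: "nat \<Rightarrow> nat \<Rightarrow> complex" and l :: "nat \<Rightarrow> complex"
    assume \<sigma>: "strict_mono \<sigma>" and v: "\<And>i. i < n \<Longrightarrow> (\<lambda>k. v k i) \<longlonglongrightarrow> l i"
    interpret critical_regime \<gamma> q "\<lambda>k. M (\<sigma> k)" "\<lambda>k. N (\<sigma> k)" u
    proof
      show "filterlim (\<lambda>k. N (\<sigma> k)) at_top sequentially"
        by (rule filterlim_compose[OF N_top filterlim_subseq[OF \<sigma>]])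
      show "(\<lambda>k. real (M (\<sigma> k)) / real (N (\<sigma> k))) \<longlonglongrightarrow> \<gamma>"
        using LIMSEQ_subseq_LIMSEQ[OF gamma(2) \<sigma>] by (simp add: o_def)
    qed (use gamma q M_pos N_pos u_norm in auto)
    \<comment> \<open>The determinantal formula for \<open>R\<close> is given at points with nonzero
      coordinates, which these are from some index on.\<close>
    have "\<forall>\<^sub>F k in sequentially. \<forall>i<n. z k (v k i) \<noteq> 0"
      by (rule z_eventually_nonzero) (rule v)
    then have eq: "\<forall>\<^sub>F k in sequentially.
        of_real ((cmod (\<Prod>i<n. z k (v k i)))\<^sup>2) *
          kernel_det (ginibre_kernel c (M (\<sigma> k)) (N (\<sigma> k))) n (\<lambda>i. z k (v k i)) =
        (let z = (\<lambda>i. crit_point \<gamma> q u (M (\<sigma> k)) (N (\<sigma> k)) (v k i))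
            in complex_of_real ((cmod (\<Prod>i<n. z i))\<^sup>2) * R (M (\<sigma> k)) (N (\<sigma> k)) z)"
    proof eventually_elim
      case (elim k)
      then have "R (M (\<sigma> k)) (N (\<sigma> k)) (\<lambda>i. z k (v k i)) =
          kernel_det (ginibre_kernel c (M (\<sigma> k)) (N (\<sigma> k))) n (\<lambda>i. z k (v k i))"
        by (intro determinantal M_pos N_pos) auto
      then show ?case by (simp add: Let_def z_def)
    qed
    show "(\<lambda>k. let z = (\<lambda>i. crit_point \<gamma> q u (M (\<sigma> k)) (N (\<sigma> k)) (v k i))
            in complex_of_real ((cmod (\<Prod>i<n. z i))\<^sup>2) * R (M (\<sigma> k)) (N (\<sigma> k)) z)
        \<longlonglongrightarrow> (if q = 0 then kernel_det (crit_edge_kernel \<gamma>) n l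
          else kernel_det (crit_bulk_kernel (\<gamma> / (1 - q))) n l)"
      by (rule Lim_transform_eventually[OF kernel_det_tendsto[of c n v l, OF c] eq]) (rule v)
  qed
qed

end
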